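(* Let $f\in\ell_\beta$, $\beta>0$. Then $(-\Delta_d)^\beta f$ is well defined and there is a constant $C>0$ (independent of $n$) such that $$|(-\Delta_d)^\beta f(n)|\le C\sum_{j\in\mathbb{Z}}\frac{|f(j)|}{1+|n-j|^{1+2\beta}},\qquad n\in\mathbb{Z}.$$ Moreover, in that case, $$(-\Delta_d)^\beta f(n)=\sum_{j\in\mathbb{Z}}K_\beta(j)\,(f(n-j)-f(n)),\qquad n\in\mathbb{Z}.$$
   Context: For $\beta>0$, $\ell_\beta=\{u:\mathbb{Z}\to\mathbb{R}:\ \sum_{m\in\mathbb{Z}}\frac{|u(m)|}{(1+|m|)^{1+2\beta}}<\infty\}$. Heat semigroup: $I_n(t)=\sum_{m=0}^\infty\frac{1}{m!\,\Gamma(m+n+1)}(t/2)^{2m+n}$ for $n\in\mathbb{N}_0$, $I_{-n}=I_n$; $G(t,n)=e^{-2t}I_n(2t)$ for $t>0$, $n\in\mathbb{Z}$; $e^{t\Delta_d}f(n)=\sum_{j\in\mathbb{Z}}G(t,n-j)f(j)$, where $\Delta_df(n)=f(n+1)-2f(n)+f(n-1)$. For $\beta>0$, $(-\Delta_d)^\beta$ is defined by $(-\Delta_d)^\beta f(n)=\frac{1}{c_\beta}\int_0^\infty\left(e^{\tau\Delta_d}-I\right)^{[\beta]+1}f(n)\frac{d\tau}{\tau^{1+\beta}}$, $n\in\mathbb{Z}$, with $c_\beta=\int_0^\infty(e^{-\tau}-1)^{[\beta]+1}\frac{d\tau}{\tau^{1+\beta}}$, $I$ the identity operator and $[\cdot]$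 the integer part; "well defined" means that this expression converges for each $n$. The kernel $K_\beta$ is: $K_\beta(n)=0$ if $|n|-\beta-1\in\mathbb{N}_0$, and $K_\beta(n)=\frac{(-1)^{|n|}\Gamma(2\beta+1)}{\Gamma(1+\beta+|n|)\Gamma(1+\beta-|n|)}$ otherwise, $n\in\mathbb{Z}$. *)

theory Defs
  imports "HOL-Analysis.Analysis"
begin

definition ell :: "real \<Rightarrow> (int \<Rightarrow> real) set" where
  "ell \<beta> = {u. (\<lambda>m. \<bar>u m\<bar> / (1 + real_of_int \<bar>m\<bar>) powr (1 + 2 * \<beta>)) summable_on UNIV}"

definition besselI_nat :: "nat \<Rightarrow> real \<Rightarrow> real" where
  "besselI_nat n t =
     (\<Sum>m. 1 / (fact m * Gamma (real m + real n + 1)) * (t / 2) ^ (2 * m + n))"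

definition besselI :: "int \<Rightarrow> real \<Rightarrow> real" where
  "besselI n t = besselI_nat (nat \<bar>n\<bar>) t"

definition heat_kernel :: "real \<Rightarrow> int \<Rightarrow> real" where
  "heat_kernel t n = exp (- 2 * t) * besselI n (2 * t)"

definition heat_semigroup :: "real \<Rightarrow> (int \<Rightarrow> real) \<Rightarrow> int \<Rightarrow> real" where
  "heat_semigroup t f n = (\<Sum>\<^sub>\<infinity>j\<in>UNIV. heat_kernel t (n - j) * f j)"

definition heat_diff :: "real \<Rightarrow> (int \<Rightarrow> real) \<Rightarrow> int \<Rightarrow> real" where
  "heat_diff t f n = heat_semigroup t f n - f n"

definition frac_order :: "real \<Rightarrow> nat" where
  "frac_order \<beta> = nat \<lfloor>\<beta>\<rfloor> + 1"

definition frac_const :: "real \<Rightarrow> real" where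
  "frac_const \<beta> =
     (LBINT \<tau>:{0<..}. (exp (- \<tau>) - 1) ^ frac_order \<beta> / \<tau> powr (1 + \<beta>))"

definition frac_integrand :: "real \<Rightarrow> (int \<Rightarrow> real) \<Rightarrow> int \<Rightarrow> real \<Rightarrow> real" where
  "frac_integrand \<beta> f n \<tau> = (heat_diff \<tau> ^^ frac_order \<beta>) f n / \<tau> powr (1 + \<beta>)"

definition frac_laplacian :: "real \<Rightarrow> (int \<Rightarrow> real) \<Rightarrow> int \<Rightarrow> real" where
  "frac_laplacian \<beta> f n = 1 / frac_const \<beta> * (LBINT \<tau>:{0<..}. frac_integrand \<beta> f n \<tau>)"

(* Convergence of everything entering frac_laplacian that depends on f: each series occurring
   when the operator power is built up by iteration, and the integral itself (absolutely). *)
definition frac_laplacian_well_defined :: "real \<Rightarrow> (int \<Rightarrow> real) \<Rightarrow> bool" where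
  "frac_laplacian_well_defined \<beta> f \<longleftrightarrow>
     (\<forall>\<tau>>0. \<forall>i<frac_order \<beta>. \<forall>n.
        (\<lambda>j. heat_kernel \<tau> (n - j) * (heat_diff \<tau> ^^ i) f j) summable_on UNIV) \<and>
     (\<forall>n. set_integrable lborel {0<..} (frac_integrand \<beta> f n))"

definition frac_kernel :: "real \<Rightarrow> int \<Rightarrow> real" where
  "frac_kernel \<beta> n =
     (if real_of_int \<bar>n\<bar> - \<beta> - 1 \<in> \<nat> then 0
      else (- 1) ^ nat \<bar>n\<bar> * Gamma (2 * \<beta> + 1) /
        (Gamma (1 + \<beta> + real_of_int \<bar>n\<bar>) * Gamma (1 + \<beta> - real_of_int \<bar>n\<bar>)))"

end

theory Submission
  imports Defs
begin

text \<open>On the Fourier side \<open>-\<Delta>\<^sub>d\<close> is multiplication by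
  \<open>\<lambda>(\<theta>) = 2 - 2 cos \<theta>\<close>, the heat semigroup is multiplication by \<open>exp (- t \<lambda>)\<close>, and
  \<open>(exp (\<tau> \<Delta>\<^sub>d) - I)\<^sup>k\<close> is multiplication by \<open>(exp (- \<tau> \<lambda>) - 1)\<^sup>k\<close>. Integrating the latter against
  \<open>\<tau>\<close> to the power \<open>-1 - \<beta>\<close> gives \<open>c\<^sub>\<beta>\<close> times the \<open>\<beta>\<close>-th power of \<open>\<lambda>\<close>. The theorem says that the Fourier
  coefficients of this function are the numbers \<open>K\<^sub>\<beta>\<close>, and that every interchange of sums and
  integrals on the way is legitimate for data that merely lie in \<open>\<ell>\<^sub>\<beta>\<close>.

  Let \<open>H\<^sub>k(\<tau>, m)\<close> be the \<open>m\<close>-th Fourier coefficient of \<open>(exp (- \<tau> \<lambda>) - 1)\<^sup>k\<close>, with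
  \<open>k = [\<beta>] + 1\<close>. The heart of the matter is the bound (\<open>diff_kernel_decay\<close>), with \<open>r = 1 + |m|\<close>,
  that \<open>|H\<^sub>k(\<tau>, m)|\<close> is at most \<open>(C / r) min(1, \<tau> / r\<^sup>2)\<^sup>k\<close>. Since \<open>0 < \<beta> < k\<close>, the
  right-hand side is integrable against the weight, and the substitution \<open>\<tau> = r\<^sup>2 u\<close> turns its
  integral into a constant times \<open>r\<close> to the power \<open>-1 - 2\<beta>\<close>. This is exactly the decay dual to
  \<open>\<ell>\<^sub>\<beta>\<close>: it yields absolute convergence, the pointwise estimate and the interchange of the sum over
  the lattice with the integral over \<open>\<tau>\<close>.

  The bound rests on three elementary facts about the heat kernel \<open>G\<close>. The generating function of
  the Bessel functions shows that \<open>G(t, _)\<close> is a probability distribution with explicit exponential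
  moments; it decreases in \<open>|n|\<close> (\<open>heat_kernel_antimono\<close>), which turns a Chernoff
  bound for its tail into a pointwise bound with the additional factor \<open>1 / |n|\<close>
  (\<open>heat_kernel_Chernoff\<close>); and it is at most \<open>t\<^sup>n / n!\<close>, which is
  what is needed for small times (\<open>heat_kernel_le_power_fact\<close>).

  The coefficients of the \<open>\<beta>\<close>-th power of \<open>\<lambda>\<close> are found from a first-order recurrence in \<open>m\<close>, which
  expresses that a certain total derivative integrates to zero, and from a Beta integral at
  \<open>m = 0\<close> (\<open>cos_coeff_symb_powr\<close>). That \<open>(exp (\<tau> \<Delta>\<^sub>d) - I)\<^sup>k\<close> acts on
  the sequence by convolution with \<open>H\<^sub>k(\<tau>, _)\<close> holds for every sequence of at most exponential growth
  \<open>exp |j|\<close> (\<open>heat_diff_funpow_has_sum\<close>). Finally, the constant sequence \<open>1\<close> lies in \<open>\<ell>\<^sub>\<beta>\<close> and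
  is annihilated, so \<open>K\<^sub>\<beta>\<close> has sum zero; this is why \<open>f(n)\<close> may be subtracted in the last formula.\<close>

section \<open>The generating function of the Bessel functions\<close>

lemma has_sum_exp:
  fixes z :: "'a::{real_normed_field,banach}"
  shows "((\<lambda>k. z ^ k / fact k) has_sum exp z) UNIV"
    and "(\<lambda>k. norm (z ^ k / fact k)) summable_on UNIV"
proof -
  have eq: "(\<lambda>k. z ^ k /\<^sub>R fact k) = (\<lambda>k. z ^ k / fact k)"
    by (auto simp: scaleR_conv_of_real divide_inverse mult.commute)
  have s: "summable (\<lambda>k. norm (z ^ k / fact k))"
    using summable_norm_exp[of z] by (simp add: eq[THEN fun_cong, symmetric])
  show "((\<lambda>k. z ^ k / fact k) has_sum exp z) UNIV"
    using norm_summable_imp_has_sum[OF s] exp_converges[of z] by (simp add: eq)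
  show "(\<lambda>k. norm (z ^ k / fact k)) summable_on UNIV"
    using s by (simp add: summable_on_UNIV_nonneg_real_iff)
qed

lemma has_sum_Times:
  fixes u :: "'i \<Rightarrow> 'a::{real_normed_field,banach}"
  assumes "(u has_sum U) A" "(\<lambda>x. norm (u x)) summable_on A" "(v has_sum V) B" "(\<lambda>y. norm (v y)) summable_on B"
  shows "((\<lambda>(x,y). u x * v y) has_sum U * V) (A \<times> B)"
    and "(\<lambda>p. norm (case p of (x,y) \<Rightarrow> u x * v y)) summable_on (A \<times> B)"
proof -
  show abs: "(\<lambda>p. norm (case p of (x,y) \<Rightarrow> u x * v y)) summable_on (A \<times> B)"
    unfolding Infinite_Sum.abs_summable_on_Sigma_iff using assms(2,4)
    by (auto simp: norm_mult infsum_cmult_right' abs_mult intro!: summable_on_cmult_right summable_on_cmult_left)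
  show "((\<lambda>(x,y). u x * v y) has_sum U * V) (A \<times> B)"
  proof (rule has_sum_SigmaI)
    show "(\<lambda>(x,y). u x * v y) summable_on A \<times> B"
      using abs by (rule abs_summable_summable)
    show "((\<lambda>x. u x * V) has_sum U * V) A"
      using assms(1) by (rule has_sum_cmult_left)
    show "((\<lambda>y. (case (x, y) of (x,y) \<Rightarrow> u x * v y)) has_sum u x * V) B" for x
      using has_sum_cmult_right[OF assms(3), of "u x"] by simp
  qed
qed

lemma besselI_has_sum:
  fixes t :: real
  shows "((\<lambda>m. t ^ (2 * m + nat \<bar>n\<bar>) / (fact m * fact (m + nat \<bar>n\<bar>))) has_sum besselI n (2 * t)) UNIV"
    (is "(?f has_sum _) _")
proof -
  let ?k = "nat \<bar>n\<bar>"
  have "summable (\<lambda>m. norm (?f m))"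
  proof (rule summable_comparison_test')
    show "summable (\<lambda>m. \<bar>t\<bar> ^ ?k * ((t\<^sup>2) ^ m / fact m))"
      using has_sum_exp(2)[of "t\<^sup>2"]
      by (intro summable_mult) (simp add: summable_on_UNIV_nonneg_real_iff)
    show "norm (norm (?f m)) \<le> \<bar>t\<bar> ^ ?k * ((t\<^sup>2) ^ m / fact m)" for m
    proof -
      have "norm (norm (?f m)) = \<bar>t\<bar> ^ ?k * ((t\<^sup>2) ^ m / fact m) / fact (m + ?k)"
        by (simp add: abs_mult power_add power_mult power_abs)
      also have "\<dots> \<le> \<bar>t\<bar> ^ ?k * ((t\<^sup>2) ^ m / fact m) / 1"
        by (intro divide_left_mono) auto
      finally show ?thesis by simp
    qed
  qed
  moreover have "besselI n (2 * t) = (\<Sum>m. ?f m)"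
  proof -
    have "Gamma (real m + real ?k + 1) = fact (m + ?k)" for m
      using Gamma_fact[of "m + ?k", where ?'a = real] by (simp add: add_ac)
    thus ?thesis by (simp add: besselI_def besselI_nat_def)
  qed
  ultimately show ?thesis
    by (metis norm_summable_imp_has_sum summable_norm_cancel summable_sums)
qed

text \<open>Among the products of a term of \<open>exp (t z)\<close>, of index \<open>a\<close>, and a term of \<open>exp (t / z)\<close>, of
  index \<open>b\<close>, those with \<open>a - b = n\<close> make up the power series of \<open>I\<^sub>n(2t) z\<^sup>n\<close>.\<close>

lemma besselI_generating_function:
  fixes z :: "'a::{real_normed_field,banach}"
  assumes "z \<noteq> 0"
  shows "((\<lambda>n. of_real (besselI n (2 * t)) * z powi n) has_sum exp (of_real t * (z + 1 / z))) UNIV"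
proof -
  define w where "w = (of_real t :: 'a)"
  define F where "F = (\<lambda>(a, b). ((w * z) ^ a / fact a) * ((w / z) ^ b / fact b))"
  \<comment> \<open>\<open>n\<close> is the difference of the two indices and \<open>m\<close> is their minimum.\<close>
  define g where "g = (\<lambda>(n::int, m::nat). (m + nat n, m + nat (- n)))"
  have "(F has_sum exp (w * z) * exp (w / z)) (UNIV \<times> UNIV)"
    unfolding F_def by (intro has_sum_Times has_sum_exp)
  also have "exp (w * z) * exp (w / z) = exp (of_real t * (z + 1 / z))"
    by (simp add: w_def exp_add[symmetric] algebra_simps)
  finally have *: "(F has_sum exp (of_real t * (z + 1 / z))) (UNIV \<times> UNIV)" .
  have "bij_betw g (UNIV \<times> UNIV) (UNIV \<times> UNIV)"
    by (rule bij_betwI[of _ _ _ "\<lambda>(a, b). (int a - int b, min a b)"]) (auto simp: g_def)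
  hence **: "((\<lambda>x. F (g x)) has_sum exp (of_real t * (z + 1 / z))) (UNIV \<times> UNIV)"
    using * by (simp add: has_sum_reindex_bij_betw)
  show ?thesis
  proof (rule has_sum_SigmaD[OF **])
    fix n :: int
    have eq: "F (g (n, m)) =
      of_real (t ^ (2 * m + nat \<bar>n\<bar>) / (fact m * fact (m + nat \<bar>n\<bar>))) * z powi n" for m
    proof (cases "n \<ge> 0")
      case True
      then obtain k where n: "n = int k" using nonneg_int_cases by blast
      show ?thesis using assms unfolding n F_def g_def w_def
        by (simp add: power_add power_mult_distrib power_divide field_simps mult_2 mult_2_right)
    next
      case False
      then obtain k where n: "n = - int k" by (metis int_cases2 nat_int of_nat_0_le_iff)
      show ?thesis using assms unfolding n F_def g_def w_def
        by (simp add: power_add power_mult_distrib power_divide field_simps mult_2 mult_2_right power_int_minus)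
    qed
    show "((\<lambda>m. F (g (n, m))) has_sum of_real (besselI n (2 * t)) * z powi n) UNIV"
      unfolding eq by (intro has_sum_cmult_left has_sum_of_real besselI_has_sum)
  qed
qed

lemma besselI_nonneg: "t \<ge> 0 \<Longrightarrow> besselI n (2 * t) \<ge> 0"
  by (rule has_sum_nonneg[OF besselI_has_sum]) auto

lemma heat_kernel_nonneg: "t \<ge> 0 \<Longrightarrow> heat_kernel t n \<ge> 0"
  by (simp add: heat_kernel_def besselI_nonneg)

text \<open>The Fourier multiplier of \<open>-\<Delta>\<^sub>d\<close>.\<close>

definition symb :: "real \<Rightarrow> real" where "symb \<theta> = 2 - 2 * cos \<theta>"

text \<open>The generating function at \<open>z = exp s\<close>: the exponential moments of the heat kernel, used below
  for the Chernoff bound.\<close>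

lemma heat_kernel_exp_has_sum:
  "((\<lambda>n. heat_kernel t n * exp (s * of_int n)) has_sum exp (t * (exp s + exp (- s) - 2))) UNIV"
proof -
  have "((\<lambda>n. exp (- 2 * t) * (of_real (besselI n (2 * t)) * exp s powi n)) has_sum
     exp (- 2 * t) * exp (of_real t * (exp s + 1 / exp s))) UNIV"
    by (intro has_sum_cmult_right besselI_generating_function) auto
  also have "exp (- 2 * t) * exp (of_real t * (exp s + 1 / exp s)) =
      exp (t * (exp s + exp (- s) - 2))"
    by (simp add: exp_minus inverse_eq_divide right_diff_distrib exp_diff distrib_left mult.commute)
  finally show ?thesis
    by (simp add: heat_kernel_def exp_power_int ac_simps)
qed

text \<open>The generating function on the unit circle, at \<open>z = cis (- \<theta>)\<close>. The translation by \<open>n\<close> is built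
  in, because the cosines are then eigenfunctions of convolution with the heat kernel.\<close>

lemma heat_kernel_cos_has_sum:
  "((\<lambda>j. heat_kernel t (n - j) * cos (of_int j * \<theta>)) has_sum exp (- t * symb \<theta>) * cos (of_int n * \<theta>)) UNIV"
proof -
  define g where "g = (\<lambda>j. Re (of_real (exp (- 2 * t)) * cis (of_int n * \<theta>) *
        (of_real (besselI j (2 * t)) * cis (- \<theta>) powi j)))"
  have "(g has_sum Re (of_real (exp (- 2 * t)) * cis (of_int n * \<theta>) *
        exp (of_real t * (cis (- \<theta>) + 1 / cis (- \<theta>))))) UNIV"
    unfolding g_def by (intro has_sum_Re has_sum_cmult_right besselI_generating_function) auto
  also have "cis (- \<theta>) + 1 / cis (- \<theta>) = of_real (2 * cos \<theta>)"
    by (simp add: complex_eq_iff divide_inverse cis_inverse)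
  also have "Re (of_real (exp (- 2 * t)) * cis (of_int n * \<theta>) * exp (of_real t * of_real (2 * cos \<theta>))) =
     exp (- t * symb \<theta>) * cos (of_int n * \<theta>)"
  proof -
    have "of_real (exp (- 2 * t)) * cis (of_int n * \<theta>) * exp (of_real t * of_real (2 * cos \<theta>)) =
        of_real (exp (- t * symb \<theta>)) * cis (of_int n * \<theta>)"
      unfolding of_real_mult[symmetric] exp_of_real
      by (simp add: symb_def right_diff_distrib exp_diff exp_minus inverse_eq_divide ac_simps)
    thus ?thesis by (simp only:) simp
  qed
  also have "g = (\<lambda>j. heat_kernel t j * cos (of_int (n - j) * \<theta>))"
    by (auto simp: fun_eq_iff g_def heat_kernel_def cis_power_int cos_diff algebra_simps)
  finally have "((\<lambda>j. heat_kernel t j * cos (of_int (n - j) * \<theta>)) has_sum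
      exp (- t * symb \<theta>) * cos (of_int n * \<theta>)) UNIV" .
  moreover have "bij_betw (\<lambda>j. n - j) UNIV (UNIV :: int set)"
    by (rule bij_betwI[of _ _ _ "\<lambda>j. n - j"]) auto
  ultimately show ?thesis
    using has_sum_reindex_bij_betw[of "\<lambda>j. n - j" UNIV UNIV
        "\<lambda>j. heat_kernel t j * cos (of_int (n - j) * \<theta>)"]
    by simp
qed

lemma heat_kernel_has_sum_1: "(heat_kernel t has_sum 1) UNIV"
  using heat_kernel_exp_has_sum[of t 0] by simp

text \<open>At time zero only the power \<open>0 ^ 0 = 1\<close> survives in the series, so the semigroup starts at the
  identity and the formulas below hold for all \<open>t \<ge> 0\<close>.\<close>

lemma heat_kernel_0: "heat_kernel 0 n = (if n = 0 then 1 else 0)"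
proof -
  have "((\<lambda>m. if m = 0 then (if n = 0 then 1 else 0) else 0) has_sum (if n = 0 then 1 else (0::real))) (UNIV::nat set)"
    by (rule has_sum_finite_neutralI[of "{0}"]) auto
  moreover have "(\<lambda>m. 0 ^ (2 * m + nat \<bar>n\<bar>) / (fact m * fact (m + nat \<bar>n\<bar>))) =
      (\<lambda>m. if m = 0 then (if n = 0 then 1 else 0) else (0::real))"
    by (auto simp: fun_eq_iff)
  ultimately show ?thesis
    using besselI_has_sum[of 0 n] has_sum_unique by (fastforce simp: heat_kernel_def)
qed

lemma borel_measurable_heat_kernel [measurable]: "(\<lambda>t. heat_kernel t n) \<in> borel_measurable borel"
  unfolding heat_kernel_def besselI_def besselI_nat_def by measurable

section \<open>Pointwise bounds for the heat kernel\<close>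

lemma heat_kernel_le_1:
  assumes "t \<ge> 0" shows "heat_kernel t n \<le> 1"
proof -
  have "sum (heat_kernel t) {n} \<le> infsum (heat_kernel t) UNIV"
    using heat_kernel_has_sum_1[of t] assms
    by (intro finite_sum_le_infsum) (auto simp: heat_kernel_nonneg summable_on_def)
  thus ?thesis using heat_kernel_has_sum_1[of t] by (simp add: infsumI)
qed

text \<open>By the inequality of arithmetic and geometric means, the \<open>m\<close>-th term of the series on the left is
  at most the average of the \<open>m\<close>-th and the \<open>(m + 1)\<close>-st term of the series on the right.\<close>

lemma besselI_Suc_le:
  assumes t: "t \<ge> 0"
  shows "besselI (int (Suc n)) (2 * t) \<le> besselI (int n) (2 * t)"
proof -
  define a where "a = (\<lambda>m. t ^ (2 * m + n) / (fact m * fact (m + n)))"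
  define b where "b = (\<lambda>m. t ^ (2 * m + Suc n) / (fact m * fact (m + Suc n)))"
  have a: "a sums besselI (int n) (2 * t)" and b: "b sums besselI (int (Suc n)) (2 * t)"
    using besselI_has_sum[of t "int n"] besselI_has_sum[of t "int (Suc n)"]
    by (auto simp: a_def b_def nat_add_distrib intro!: has_sum_imp_sums)
  have "(\<lambda>m. a (Suc m)) sums (besselI (int n) (2 * t) - a 0)"
    using a by (simp add: sums_Suc_iff)
  hence "(\<lambda>m. (a m + a (Suc m)) / 2) sums
      ((besselI (int n) (2 * t) + (besselI (int n) (2 * t) - a 0)) / 2)"
    by (intro sums_divide sums_add a)
  moreover have "b m \<le> (a m + a (Suc m)) / 2" for m
  proof -
    define p q where "p = real m + 1" and "q = real m + real n + 1"
    have pq: "p > 0" "q > 0" "p \<le> q" by (auto simp: p_def q_def)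
    have "0 \<le> (p - t)\<^sup>2" by simp
    also have "\<dots> = p * p + t * t - 2 * t * p" by (simp add: power2_eq_square algebra_simps)
    also have "\<dots> \<le> p * q + t * t - 2 * t * p" using pq by (simp add: mult_left_mono)
    finally have "t / q \<le> (1 + t * t / (p * q)) / 2"
      using pq by (simp add: field_simps)
    hence "a m * (t / q) \<le> a m * ((1 + t * t / (p * q)) / 2)"
      using t by (intro mult_left_mono) (auto simp: a_def)
    moreover have "b m = a m * (t / q)"
      by (simp add: a_def b_def q_def add_ac mult_ac)
    moreover have "a (Suc m) = a m * (t * t / (p * q))"
      by (simp add: a_def p_def q_def algebra_simps)
    ultimately show ?thesis by (simp add: algebra_simps)
  qed
  ultimately have "besselI (int (Suc n)) (2 * t) \<le>
      (besselI (int n) (2 * t) + (besselI (int n) (2 * t) - a 0)) / 2"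
    using b by (meson sums_le)
  moreover have "a 0 \<ge> 0" using t by (simp add: a_def)
  moreover have "x \<le> y" if "x \<le> (y + (y - z)) / 2" "z \<ge> 0" for x y z :: real
    using that by simp
  ultimately show ?thesis by blast
qed

lemma heat_kernel_antimono:
  assumes "t \<ge> 0" "i \<le> j"
  shows "heat_kernel t (int j) \<le> heat_kernel t (int i)"
proof (rule lift_Suc_antimono_le[OF _ assms(2)])
  show "heat_kernel t (int (Suc n)) \<le> heat_kernel t (int n)" for n
    using besselI_Suc_le[OF assms(1)] by (simp add: heat_kernel_def)
qed

text \<open>Termwise, \<open>(m + n)! \<ge> m! n!\<close> reduces the series for \<open>n\<close> to that for \<open>0\<close>, which is controlled by
  the total mass.\<close>

lemma heat_kernel_le_power_fact:
  assumes t: "t \<ge> 0"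
  shows "heat_kernel t (int n) \<le> t ^ n / fact n"
proof -
  have "besselI (int n) (2 * t) \<le> t ^ n / fact n * besselI 0 (2 * t)"
  proof (rule has_sum_mono[OF besselI_has_sum has_sum_cmult_right[OF besselI_has_sum]])
    fix m
    have "fact m * fact n \<le> (fact (m + n) :: nat)"
      by (intro dvd_imp_le fact_fact_dvd_fact) simp
    hence "real (fact m * fact n) \<le> real (fact (m + n))"
      by linarith
    hence le: "fact m * fact n \<le> (fact (m + n) :: real)" by simp
    have "t ^ (2 * m + n) / (fact m * fact (m + n)) \<le> t ^ (2 * m + n) / (fact m * (fact m * fact n))"
      using t by (intro divide_left_mono mult_left_mono le) auto
    thus "t ^ (2 * m + nat \<bar>int n\<bar>) / (fact m * fact (m + nat \<bar>int n\<bar>)) \<le>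
        t ^ n / fact n * (t ^ (2 * m + nat \<bar>0\<bar>) / (fact m * fact (m + nat \<bar>0\<bar>)))"
      by (simp add: power_add mult_ac)
  qed
  hence "heat_kernel t (int n) \<le> t ^ n / fact n * heat_kernel t 0"
    using mult_left_mono[of _ _ "exp (- 2 * t)"] by (fastforce simp: heat_kernel_def mult_ac)
  also have "\<dots> \<le> t ^ n / fact n * 1"
    using t by (intro mult_left_mono heat_kernel_le_1) auto
  finally show ?thesis by simp
qed

text \<open>Pair \<open>j\<close> with \<open>n + 1 - j\<close>: the two exponentials have mean at least \<open>exp (s (n + 1) / 2)\<close>.\<close>

lemma sum_exp_ge:
  assumes "s \<ge> (0::real)"
  shows "real n * exp (s * real n / 2) \<le> (\<Sum>j=1..n. exp (s * real j))"
proof -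
  have "2 * (\<Sum>j=1..n. exp (s * real j)) =
      (\<Sum>j=1..n. exp (s * real j)) + (\<Sum>j=1..n. exp (s * real (n + 1 - j)))"
    using sum.atLeastAtMost_rev[of "\<lambda>j. exp (s * real j)" 1 n] by simp
  also have "\<dots> = (\<Sum>j=1..n. exp (s * real j) + exp (s * real (n + 1 - j)))"
    by (simp add: sum.distrib)
  also have "\<dots> \<ge> (\<Sum>j=1..n. 2 * exp (s * real n / 2))"
  proof (rule sum_mono)
    fix j assume j: "j \<in> {1..n}"
    define x y where "x = exp (s * real j / 2)" and "y = exp (s * real (n + 1 - j) / 2)"
    have "0 \<le> (x - y)\<^sup>2" by simp
    also have "\<dots> = x\<^sup>2 + y\<^sup>2 - 2 * (x * y)" by (simp add: power2_eq_square algebra_simps)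
    finally have "2 * (x * y) \<le> x\<^sup>2 + y\<^sup>2" by simp
    moreover have "x\<^sup>2 = exp (s * real j)" "y\<^sup>2 = exp (s * real (n + 1 - j))"
      by (simp_all add: x_def y_def power2_eq_square exp_add[symmetric])
    moreover have "x * y = exp (s * (real n + 1) / 2)"
      using j by (simp add: x_def y_def exp_add[symmetric] of_nat_diff field_simps)
    moreover have "exp (s * real n / 2) \<le> exp (s * (real n + 1) / 2)"
      using assms by (simp add: algebra_simps)
    ultimately show "2 * exp (s * real n / 2) \<le> exp (s * real j) + exp (s * real (n + 1 - j))"
      by linarith
  qed
  finally show ?thesis by simp
qed

text \<open>The exponential moment bounds \<open>exp (s j) G(t, j)\<close> summed over \<open>1 \<le> j \<le> n\<close>; by monotonicity each
  factor \<open>G(t, j)\<close> is at least \<open>G(t, n)\<close>. Averaging over \<open>n\<close> sites instead of using the single site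
  \<open>n\<close> is what gains the factor \<open>n\<close> on the left.\<close>

lemma heat_kernel_Chernoff:
  assumes t: "t \<ge> 0" and s: "s \<ge> 0"
  shows "real n * heat_kernel t (int n) \<le> exp (- s * real n / 2) * exp (t * (exp s + exp (- s) - 2))"
proof -
  let ?M = "exp (t * (exp s + exp (- s) - 2))"
  let ?g = "\<lambda>j. heat_kernel t j * exp (s * of_int j)"
  have "heat_kernel t (int n) * (real n * exp (s * real n / 2)) \<le>
      heat_kernel t (int n) * (\<Sum>j=1..n. exp (s * real j))"
    by (intro mult_left_mono sum_exp_ge s heat_kernel_nonneg t)
  also have "\<dots> \<le> (\<Sum>j=1..n. ?g (int j))"
    unfolding sum_distrib_left by (intro sum_mono mult_mono heat_kernel_antimono heat_kernel_nonneg t) auto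
  also have "\<dots> = sum ?g (int ` {1..n})"
    by (subst sum.reindex) (auto simp: inj_on_def)
  also have "\<dots> \<le> infsum ?g UNIV"
    using heat_kernel_exp_has_sum[of t s] t
    by (intro finite_sum_le_infsum) (auto simp: heat_kernel_nonneg summable_on_def)
  also have "\<dots> = ?M"
    using heat_kernel_exp_has_sum by (rule infsumI)
  finally show ?thesis by (simp add: exp_minus field_simps)
qed

text \<open>The choice \<open>s = 1 / sqrt t\<close>, on the diffusive scale, keeps the exponential moment bounded.\<close>

lemma heat_kernel_le_exp:
  assumes t: "t \<ge> 1"
  shows "real n * heat_kernel t (int n) \<le> exp 2 * exp (- real n / (2 * sqrt t))"
proof -
  define s where "s = 1 / sqrt t"
  have s: "s \<ge> 0" "s \<le> 1" "t * s\<^sup>2 = 1" using t by (auto simp: s_def power_divide)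
  have "exp s \<le> 1 + s + s\<^sup>2" using s by (intro exp_bound)
  moreover have "exp (- s) \<le> 1 - s + s\<^sup>2"
  proof -
    have "(1 - s + s\<^sup>2) * (1 + s) = 1 + s ^ 3"
      by (simp add: power2_eq_square power3_eq_cube algebra_simps)
    hence "1 \<le> (1 - s + s\<^sup>2) * (1 + s)" using s by simp
    also have "\<dots> \<le> (1 - s + s\<^sup>2) * exp s"
      using s by (intro mult_left_mono exp_ge_add_one_self) auto
    finally show ?thesis by (simp add: exp_minus field_simps)
  qed
  ultimately have "t * (exp s + exp (- s) - 2) \<le> t * (2 * s\<^sup>2)"
    using t by (intro mult_left_mono) auto
  also have "\<dots> = 2" using s(3) by (simp add: mult_ac)
  finally have "exp (t * (exp s + exp (- s) - 2)) \<le> exp 2" by simp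
  hence "exp (- s * real n / 2) * exp (t * (exp s + exp (- s) - 2)) \<le> exp (- s * real n / 2) * exp 2"
    by (intro mult_left_mono) auto
  with heat_kernel_Chernoff[of t s n] t s
  have "real n * heat_kernel t (int n) \<le> exp (- s * real n / 2) * exp 2" by linarith
  thus ?thesis by (simp add: s_def mult_ac)
qed

section \<open>Cosine coefficients and the kernel of the powers of the heat difference\<close>

text \<open>Fubini's theorem for an absolutely convergent unordered sum over the integers; the enumeration of
  the integers reduces it to ordinary series.\<close>

lemma has_sum_integral:
  fixes F :: "int \<Rightarrow> 'b \<Rightarrow> real"
  assumes int: "\<And>i. integrable M (F i)"
    and norm: "(\<lambda>i. \<integral>x. \<bar>F i x\<bar> \<partial>M) summable_on UNIV"
    and pt: "\<And>x. x \<in> space M \<Longrightarrow> ((\<lambda>i. F i x) has_sum S x) UNIV"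
  shows "integrable M S" and "((\<lambda>i. \<integral>x. F i x \<partial>M) has_sum (\<integral>x. S x \<partial>M)) UNIV"
proof -
  define G where "G = (\<lambda>k. F (int_decode k))"
  have bij: "bij_betw int_decode UNIV UNIV" by (rule bij_int_decode)
  have norm': "summable (\<lambda>k. \<integral>x. \<bar>G k x\<bar> \<partial>M)"
    using summable_on_reindex_bij_betw[OF bij, of "\<lambda>i. \<integral>x. \<bar>F i x\<bar> \<partial>M"] norm
    by (simp add: G_def summable_on_UNIV_nonneg_real_iff)
  have abs: "summable (\<lambda>k. norm (G k x))" if "x \<in> space M" for x
  proof -
    have "(\<lambda>i. \<bar>F i x\<bar>) summable_on UNIV"
      using pt[OF that] summable_on_iff_abs_summable_on_real[of "\<lambda>i. F i x" UNIV]
      by (auto simp: summable_on_def)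
    thus ?thesis
      using summable_on_reindex_bij_betw[OF bij, of "\<lambda>i. \<bar>F i x\<bar>"]
      by (simp add: G_def summable_on_UNIV_nonneg_real_iff)
  qed
  have G_int: "integrable M (G k)" for k by (simp add: G_def int)
  have S: "(\<Sum>k. G k x) = S x" if "x \<in> space M" for x
    using has_sum_imp_sums[of "\<lambda>k. G k x"] pt[OF that]
      has_sum_reindex_bij_betw[OF bij, of "\<lambda>i. F i x"] by (simp add: G_def sums_iff)
  have AE: "AE x in M. summable (\<lambda>k. norm (G k x))" using abs by simp
  have "integrable M (\<lambda>x. \<Sum>k. G k x)" 
    by (rule integrable_suminf[OF G_int AE]) (use norm' in simp)
  thus "integrable M S" using S by (simp cong: Bochner_Integration.integrable_cong)
  have "(\<lambda>k. \<integral>x. G k x \<partial>M) sums (\<integral>x. (\<Sum>k. G k x) \<partial>M)"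
    by (rule sums_integral[OF G_int AE]) (use norm' in simp)
  also have "(\<integral>x. (\<Sum>k. G k x) \<partial>M) = (\<integral>x. S x \<partial>M)"
    using S by (simp cong: Bochner_Integration.integral_cong)
  finally have sums: "(\<lambda>k. \<integral>x. G k x \<partial>M) sums (\<integral>x. S x \<partial>M)" .
  have "summable (\<lambda>k. norm (\<integral>x. G k x \<partial>M))"
    by (rule summable_comparison_test'[OF norm']) (auto intro: integral_abs_bound)
  from norm_summable_imp_has_sum[OF this sums]
  show "((\<lambda>i. \<integral>x. F i x \<partial>M) has_sum (\<integral>x. S x \<partial>M)) UNIV"
    using has_sum_reindex_bij_betw[OF bij, of "\<lambda>i. \<integral>x. F i x \<partial>M"] by (simp add: G_def)
qed

text \<open>For an even function on the circle this is its Fourier coefficient; all multipliers below are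
  functions of \<open>\<lambda>(\<theta>) = 2 - 2 cos \<theta>\<close> and hence even.\<close>

definition cos_coeff :: "(real \<Rightarrow> real) \<Rightarrow> int \<Rightarrow> real" where
  "cos_coeff \<phi> m = 1 / pi * (LBINT \<theta>:{0..pi}. \<phi> \<theta> * cos (of_int m * \<theta>))"

lemma cos_coeff_integrable:
  assumes "continuous_on {0..pi} \<phi>"
  shows "set_integrable lborel {0..pi} (\<lambda>\<theta>. \<phi> \<theta> * cos (of_int m * \<theta>))"
  using assms by (intro borel_integrable_atLeastAtMost' continuous_intros)

lemma cos_coeff_bound:
  assumes "continuous_on {0..pi} \<phi>" "\<And>\<theta>. \<theta> \<in> {0..pi} \<Longrightarrow> \<bar>\<phi> \<theta>\<bar> \<le> B"
  shows "\<bar>cos_coeff \<phi> m\<bar> \<le> B"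
proof -
  have "\<bar>LBINT \<theta>:{0..pi}. \<phi> \<theta> * cos (of_int m * \<theta>)\<bar> \<le>
     (LBINT \<theta>:{0..pi}. \<bar>\<phi> \<theta> * cos (of_int m * \<theta>)\<bar>)"
    using set_integral_norm_bound[OF cos_coeff_integrable[OF assms(1)]] by simp
  also have "\<dots> \<le> (LBINT \<theta>:{0..pi}. B)"
  proof (rule set_integral_mono)
    show "set_integrable lborel {0..pi} (\<lambda>\<theta>. \<bar>\<phi> \<theta> * cos (of_int m * \<theta>)\<bar>)"
      using cos_coeff_integrable[OF assms(1)] by (rule set_integrable_abs)
    show "set_integrable lborel {0..pi} (\<lambda>\<theta>. B)"
      by (intro borel_integrable_atLeastAtMost' continuous_intros)
    fix \<theta> :: real assume "\<theta> \<in> {0..pi}"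
    hence "\<bar>\<phi> \<theta>\<bar> * \<bar>cos (of_int m * \<theta>)\<bar> \<le> B * 1"
      using assms(2)[of \<theta>] by (intro mult_mono) auto
    thus "\<bar>\<phi> \<theta> * cos (of_int m * \<theta>)\<bar> \<le> B" by (simp add: abs_mult)
  qed
  also have "\<dots> = pi * B" by (simp add: set_integral_const)
  finally show ?thesis by (simp add: cos_coeff_def abs_mult field_simps)
qed

lemma cos_coeff_1: "cos_coeff (\<lambda>_. 1) m = (if m = 0 then 1 else 0)"
proof (cases "m = 0")
  case False
  have "(LBINT \<theta>:{0..pi}. cos (of_int m * \<theta>)) = integral {0..pi} (\<lambda>\<theta>. cos (of_int m * \<theta>))"
    using cos_coeff_integrable[of "\<lambda>_. 1" m] by (intro set_borel_integral_eq_integral) auto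
  also have "((\<lambda>\<theta>. cos (of_int m * \<theta>)) has_integral
      (sin (of_int m * pi) / of_int m - sin (of_int m * 0) / of_int m)) {0..pi}"
    using False by (intro fundamental_theorem_of_calculus)
      (auto intro!: derivative_eq_intros simp: has_real_derivative_iff_has_vector_derivative[symmetric])
  hence "integral {0..pi} (\<lambda>\<theta>. cos (of_int m * \<theta>)) = 0"
    by (simp add: integral_unique sin_int_times_real mult.commute)
  finally show ?thesis using False by (simp add: cos_coeff_def)
qed (simp add: cos_coeff_def set_integral_const)

lemma cos_coeff_sum:
  assumes "\<And>i. i \<in> I \<Longrightarrow> continuous_on {0..pi} (\<phi> i)"
  shows "cos_coeff (\<lambda>\<theta>. \<Sum>i\<in>I. c i * \<phi> i \<theta>) m = (\<Sum>i\<in>I. c i * cos_coeff (\<phi> i) m)"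
proof -
  have "(LBINT \<theta>:{0..pi}. (\<Sum>i\<in>I. c i * \<phi> i \<theta>) * cos (of_int m * \<theta>)) =
     (LBINT \<theta>:{0..pi}. (\<Sum>i\<in>I. c i * (\<phi> i \<theta> * cos (of_int m * \<theta>))))"
    by (simp add: sum_distrib_right mult.assoc)
  also have "\<dots> = (\<Sum>i\<in>I. (LBINT \<theta>:{0..pi}. c i * (\<phi> i \<theta> * cos (of_int m * \<theta>))))"
    unfolding set_lebesgue_integral_def scaleR_sum_right
    using set_integrable_mult_right[OF cos_coeff_integrable[OF assms]]
    by (intro Bochner_Integration.integral_sum) (auto simp: set_integrable_def)
  finally show ?thesis
    by (simp add: cos_coeff_def sum_divide_distrib mult_ac)
qed

lemma continuous_on_symb [continuous_intros]: "continuous_on A symb"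
  unfolding symb_def by (intro continuous_intros)

text \<open>Convolution with the heat kernel is multiplication by \<open>exp (- t \<lambda>)\<close>. This single fact replaces
  the semigroup law: taking for \<open>\<phi>\<close> the constant \<open>1\<close> it identifies \<open>G(t, _)\<close>, and taking for
  \<open>\<phi>\<close> a power of \<open>exp (- \<tau> \<lambda>) - 1\<close> it gives the step from one power of the heat difference to
  the next.\<close>

lemma heat_kernel_conv_cos_coeff:
  assumes \<phi>: "continuous_on {0..pi} \<phi>" and t: "t \<ge> 0"
  shows "((\<lambda>j. heat_kernel t (n - j) * cos_coeff \<phi> j) has_sum
          cos_coeff (\<lambda>\<theta>. exp (- t * symb \<theta>) * \<phi> \<theta>) n) UNIV"
proof -
  define F where "F = (\<lambda>j \<theta>. heat_kernel t (n - j) *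
      (indicator {0..pi} \<theta> *\<^sub>R (\<phi> \<theta> * cos (of_int j * \<theta>))))"
  define B where "B = (\<integral>\<theta>. \<bar>indicator {0..pi} \<theta> *\<^sub>R (\<phi> \<theta> * cos (of_int 0 * \<theta>))\<bar> \<partial>lborel)"
  note I = cos_coeff_integrable[OF \<phi>, unfolded set_integrable_def]
  have G: "(\<lambda>j. heat_kernel t (n - j)) summable_on UNIV"
    using heat_kernel_cos_has_sum[of t n 0] by (auto simp: summable_on_def)
  have "((\<lambda>j. \<integral>\<theta>. F j \<theta> \<partial>lborel) has_sum
      (\<integral>\<theta>. indicator {0..pi} \<theta> *\<^sub>R (exp (- t * symb \<theta>) * \<phi> \<theta> * cos (of_int n * \<theta>)) \<partial>lborel)) UNIV"
  proof (rule has_sum_integral(2))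
    show "integrable lborel (F j)" for j
      unfolding F_def using I by (intro integrable_mult_right)
    show "(\<lambda>j. \<integral>\<theta>. \<bar>F j \<theta>\<bar> \<partial>lborel) summable_on UNIV"
    proof (rule summable_on_comparison_test)
      show "(\<lambda>j. heat_kernel t (n - j) * B) summable_on UNIV"
        using G by (rule summable_on_cmult_left)
      fix j
      have "(\<integral>\<theta>. \<bar>F j \<theta>\<bar> \<partial>lborel) =
          heat_kernel t (n - j) * (\<integral>\<theta>. \<bar>indicator {0..pi} \<theta> *\<^sub>R (\<phi> \<theta> * cos (of_int j * \<theta>))\<bar> \<partial>lborel)"
        using t by (simp add: F_def abs_mult heat_kernel_nonneg)
      also have "\<dots> \<le> heat_kernel t (n - j) * B"
        unfolding B_def using t
      proof (intro mult_left_mono integral_mono integrable_abs I heat_kernel_nonneg)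
        fix \<theta>
        have "\<bar>\<phi> \<theta>\<bar> * \<bar>cos (of_int j * \<theta>)\<bar> \<le> \<bar>\<phi> \<theta>\<bar> * 1"
          by (intro mult_left_mono) auto
        thus "\<bar>indicator {0..pi} \<theta> *\<^sub>R (\<phi> \<theta> * cos (of_int j * \<theta>))\<bar> \<le>
            \<bar>indicator {0..pi} \<theta> *\<^sub>R (\<phi> \<theta> * cos (of_int 0 * \<theta>))\<bar>"
          by (simp add: abs_mult indicator_def)
      qed
      finally show "(\<integral>\<theta>. \<bar>F j \<theta>\<bar> \<partial>lborel) \<le> heat_kernel t (n - j) * B" .
    qed auto
    fix \<theta>
    show "((\<lambda>j. F j \<theta>) has_sum
        indicator {0..pi} \<theta> *\<^sub>R (exp (- t * symb \<theta>) * \<phi> \<theta> * cos (of_int n * \<theta>))) UNIV"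
      using has_sum_cmult_left[OF heat_kernel_cos_has_sum[of t n \<theta>], of "indicator {0..pi} \<theta> * \<phi> \<theta>"]
      by (simp add: F_def mult_ac)
  qed
  hence "((\<lambda>j. 1 / pi * (\<integral>\<theta>. F j \<theta> \<partial>lborel)) has_sum cos_coeff (\<lambda>\<theta>. exp (- t * symb \<theta>) * \<phi> \<theta>) n) UNIV"
    unfolding cos_coeff_def set_lebesgue_integral_def by (rule has_sum_cmult_right)
  moreover have "(\<lambda>j. 1 / pi * (\<integral>\<theta>. F j \<theta> \<partial>lborel)) = (\<lambda>j. heat_kernel t (n - j) * cos_coeff \<phi> j)"
    by (simp add: F_def cos_coeff_def set_lebesgue_integral_def)
  ultimately show ?thesis by simp
qed

lemma heat_kernel_eq_cos_coeff:
  assumes "t \<ge> 0"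
  shows "heat_kernel t n = cos_coeff (\<lambda>\<theta>. exp (- t * symb \<theta>)) n"
proof -
  have "((\<lambda>j. if j = 0 then heat_kernel t n else 0) has_sum heat_kernel t n) (UNIV :: int set)"
    by (rule has_sum_finite_neutralI[of "{0}"]) auto
  moreover have "(\<lambda>j. if j = 0 then heat_kernel t n else 0) = (\<lambda>j. heat_kernel t (n - j) * cos_coeff (\<lambda>_. 1) j)"
    by (auto simp: cos_coeff_1 fun_eq_iff)
  ultimately show ?thesis
    using heat_kernel_conv_cos_coeff[of "\<lambda>_. 1" t n] assms has_sum_unique by fastforce
qed

text \<open>The convolution kernel of the \<open>k\<close>-th power of \<open>exp (\<tau> \<Delta>\<^sub>d) - I\<close>.\<close>

definition diff_kernel :: "nat \<Rightarrow> real \<Rightarrow> int \<Rightarrow> real" where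
  "diff_kernel k \<tau> = cos_coeff (\<lambda>\<theta>. (exp (- \<tau> * symb \<theta>) - 1) ^ k)"

lemma diff_kernel_0: "diff_kernel 0 \<tau> m = (if m = 0 then 1 else 0)"
  by (simp add: diff_kernel_def cos_coeff_1)

lemma diff_kernel_minus: "diff_kernel k \<tau> (- m) = diff_kernel k \<tau> m"
  by (simp add: diff_kernel_def cos_coeff_def)

text \<open>The binomial expansion, by which bounds on the heat kernel pass to the difference kernel.\<close>

lemma diff_kernel_eq_sum:
  assumes "\<tau> \<ge> 0"
  shows "diff_kernel k \<tau> m = (\<Sum>i\<le>k. real (k choose i) * (- 1) ^ (k - i) * heat_kernel (real i * \<tau>) m)"
proof -
  have "(\<lambda>\<theta>. (exp (- \<tau> * symb \<theta>) - 1) ^ k) =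
      (\<lambda>\<theta>. \<Sum>i\<le>k. (real (k choose i) * (- 1) ^ (k - i)) * exp (- (real i * \<tau>) * symb \<theta>))"
  proof
    fix \<theta>
    have "exp (- \<tau> * symb \<theta>) ^ i = exp (- (real i * \<tau>) * symb \<theta>)" for i
      by (simp add: exp_of_nat_mult[symmetric] mult_ac)
    thus "(exp (- \<tau> * symb \<theta>) - 1) ^ k =
        (\<Sum>i\<le>k. (real (k choose i) * (- 1) ^ (k - i)) * exp (- (real i * \<tau>) * symb \<theta>))"
      using binomial_ring[of "exp (- \<tau> * symb \<theta>)" "-1" k] by (simp add: mult_ac)
  qed
  thus ?thesis using assms
    by (simp add: diff_kernel_def cos_coeff_sum continuous_intros heat_kernel_eq_cos_coeff)
qed

lemma diff_kernel_Suc_has_sum: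
  assumes "\<tau> \<ge> 0"
  shows "((\<lambda>j. heat_kernel \<tau> (n - j) * diff_kernel k \<tau> j) has_sum
          diff_kernel (Suc k) \<tau> n + diff_kernel k \<tau> n) UNIV"
proof -
  let ?\<phi> = "\<lambda>k \<theta>. (exp (- \<tau> * symb \<theta>) - 1) ^ k"
  have c: "continuous_on {0..pi} (?\<phi> k)" for k by (intro continuous_intros)
  have "cos_coeff (\<lambda>\<theta>. exp (- \<tau> * symb \<theta>) * ?\<phi> k \<theta>) n =
     cos_coeff (\<lambda>\<theta>. \<Sum>i\<in>{k, Suc k}. 1 * ?\<phi> i \<theta>) n"
    by (simp add: algebra_simps)
  also have "\<dots> = cos_coeff (?\<phi> (Suc k)) n + cos_coeff (?\<phi> k) n"
    by (subst cos_coeff_sum) (auto intro!: continuous_intros)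
  finally show ?thesis
    using heat_kernel_conv_cos_coeff[OF c assms, of n k] by (simp add: diff_kernel_def)
qed

text \<open>The indicator restricts to positive times, where the expansion into heat kernels is available.\<close>

lemma borel_measurable_diff_kernel [measurable]:
  "(\<lambda>\<tau>. indicator {0<..} \<tau> * diff_kernel k \<tau> m) \<in> borel_measurable borel"
proof -
  have "(\<lambda>\<tau>. indicator {0<..} \<tau> * diff_kernel k \<tau> m) =
     (\<lambda>\<tau>. indicator {0<..} \<tau> * (\<Sum>i\<le>k. real (k choose i) * (- 1) ^ (k - i) * heat_kernel (real i * \<tau>) m))"
    by (auto simp: fun_eq_iff diff_kernel_eq_sum indicator_def)
  also have "\<dots> \<in> borel_measurable borel" by measurable
  finally show ?thesis .
qed

section \<open>Decay of the difference kernel\<close>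

lemma abs_exp_minus_1_le: 
  assumes "x \<ge> (0::real)" shows "\<bar>exp (- x) - 1\<bar> \<le> min 1 x"
  using assms exp_ge_add_one_self[of "- x"] by (auto simp: abs_if)

lemma symb_bounds: "0 \<le> symb \<theta>" "symb \<theta> \<le> 4"
  using cos_le_one[of \<theta>] cos_ge_minus_one[of \<theta>] unfolding symb_def by linarith+

lemma exp_symb_diff_bound:
  assumes "\<tau> \<ge> 0"
  shows "\<bar>(exp (- \<tau> * symb \<theta>) - 1) ^ k\<bar> \<le> min 1 (4 * \<tau>) ^ k"
proof -
  have "\<bar>exp (- (\<tau> * symb \<theta>)) - 1\<bar> \<le> min 1 (\<tau> * symb \<theta>)"
    using assms symb_bounds by (intro abs_exp_minus_1_le) auto
  also have "\<dots> \<le> min 1 (4 * \<tau>)"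
    using mult_left_mono[OF symb_bounds(2) assms, of \<theta>] by (intro min.mono) auto
  finally show ?thesis by (simp add: power_abs power_mono)
qed

text \<open>The only bound that sees the cancellation between the terms of the binomial expansion. It settles
  the finitely many \<open>m\<close> with \<open>|m| < k\<close>; for the others the heat kernels are small enough one by one.\<close>

lemma diff_kernel_le:
  assumes "\<tau> \<ge> 0"
  shows "\<bar>diff_kernel k \<tau> m\<bar> \<le> min 1 (4 * \<tau>) ^ k"
  unfolding diff_kernel_def
  by (intro cos_coeff_bound exp_symb_diff_bound assms continuous_intros)

lemma power_le_fact_exp:
  assumes "x \<ge> (0::real)" shows "x ^ n \<le> fact n * exp x"
proof -
  have "sum (\<lambda>k. x ^ k / fact k) {n} \<le> infsum (\<lambda>k. x ^ k / fact k) UNIV"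
    using has_sum_exp(1)[of x] assms by (intro finite_sum_le_infsum) (auto simp: summable_on_def)
  also have "\<dots> = exp x" using has_sum_exp(1) by (rule infsumI)
  finally show ?thesis by (simp add: field_simps)
qed

lemma min_power_right: "min 1 (x::real) ^ k = min 1 (x ^ k)" if "x \<ge> 0"
  using that by (auto simp: min_def power_le_one one_le_power intro: antisym)

lemma diff_kernel_le_sum:
  assumes \<tau>: "\<tau> \<ge> 0" and n: "n \<ge> 1" and B: "\<And>i. 1 \<le> i \<Longrightarrow> i \<le> k \<Longrightarrow> heat_kernel (real i * \<tau>) (int n) \<le> B"
    and B0: "B \<ge> 0"
  shows "\<bar>diff_kernel k \<tau> (int n)\<bar> \<le> 2 ^ k * B"
proof -
  have "\<bar>diff_kernel k \<tau> (int n)\<bar> \<le> (\<Sum>i\<le>k. real (k choose i) * heat_kernel (real i * \<tau>) (int n))"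
    unfolding diff_kernel_eq_sum[OF \<tau>] using \<tau>
    by (intro order_trans[OF sum_abs] sum_mono) (simp add: abs_mult heat_kernel_nonneg)
  also have "\<dots> \<le> (\<Sum>i\<le>k. real (k choose i) * B)"
  proof (intro sum_mono mult_left_mono)
    fix i assume "i \<in> {..k}"
    thus "heat_kernel (real i * \<tau>) (int n) \<le> B"
      using B[of i] n B0 by (cases "i = 0") (auto simp: heat_kernel_0)
  qed auto
  also have "\<dots> = real (\<Sum>i\<le>k. k choose i) * B" by (simp add: sum_distrib_right)
  also have "\<dots> = 2 ^ k * B" by (simp add: choose_row_sum)
  finally show ?thesis .
qed

text \<open>From \<open>G(i \<tau>, n) \<le> (i \<tau>)\<^sup>n / n!\<close>: as \<open>n \<ge> k\<close> and \<open>\<tau> \<le> 1\<close>, the factor \<open>\<tau>\<^sup>n\<close> is at most \<open>\<tau>\<^sup>k\<close>, and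
  the factorial beats every power of \<open>n\<close>. The power \<open>2 k + 1\<close> is the one that matches the bound for
  large times.\<close>

lemma diff_kernel_small_time:
  assumes k: "k \<ge> 1" and n: "k \<le> n" and \<tau>: "0 < \<tau>" "\<tau> \<le> 1"
  shows "\<bar>diff_kernel k \<tau> (int n)\<bar> \<le> 2 ^ k * (fact (2 * k + 1) * exp 1 * exp (exp 1 * real k)) / (1 + real n) *
           (\<tau> / (1 + real n)\<^sup>2) ^ k"
proof -
  let ?r = "1 + real n"
  let ?C = "fact (2 * k + 1) * exp 1 * exp (exp 1 * real k)"
  have B: "heat_kernel (real i * \<tau>) (int n) \<le> ?C / ?r * (\<tau> / ?r\<^sup>2) ^ k" if "1 \<le> i" "i \<le> k" for i
  proof -
    have "heat_kernel (real i * \<tau>) (int n) \<le> (real i * \<tau>) ^ n / fact n"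
      using \<tau> by (intro heat_kernel_le_power_fact) auto
    also have "\<dots> \<le> (real k * \<tau>) ^ n / fact n"
      using \<tau> that by (intro divide_right_mono power_mono mult_right_mono) auto
    also have "\<dots> = real k ^ n / fact n * \<tau> ^ n" by (simp add: power_mult_distrib)
    also have "\<dots> \<le> real k ^ n / fact n * \<tau> ^ k"
      using \<tau> n by (intro mult_left_mono power_decreasing) auto
    also have "real k ^ n / fact n \<le> ?C / ?r ^ (2 * k + 1)"
    proof -
      have "?r ^ (2 * k + 1) \<le> fact (2 * k + 1) * exp ?r" by (intro power_le_fact_exp) auto
      hence "real k ^ n * ?r ^ (2 * k + 1) \<le> real k ^ n * (fact (2 * k + 1) * exp ?r)"
        by (intro mult_left_mono) auto
      also have "exp ?r = exp 1 * exp 1 ^ n"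
        by (simp add: exp_add exp_of_nat_mult[symmetric])
      also have "real k ^ n * (fact (2 * k + 1) * (exp 1 * exp 1 ^ n)) =
          fact (2 * k + 1) * exp 1 * (exp 1 * real k) ^ n" by (simp add: power_mult_distrib)
      also have "\<dots> \<le> fact (2 * k + 1) * exp 1 * (fact n * exp (exp 1 * real k))"
        by (intro mult_left_mono power_le_fact_exp) auto
      finally have *: "real k ^ n * ?r ^ (2 * k + 1) \<le> ?C * fact n" by (simp only: mult_ac)
      have "a / f \<le> c / r" if "a * r \<le> c * f" "r > 0" "f > 0" for a f c r :: real
        using that by (simp add: field_simps)
      from this[OF *] show ?thesis by simp
    qed
    also have "?C / ?r ^ (2 * k + 1) * \<tau> ^ k = ?C / ?r * (\<tau> / ?r\<^sup>2) ^ k"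
      by (simp add: power_divide power_mult[symmetric])
    finally show ?thesis using \<tau> by (simp add: mult_right_mono)
  qed
  have "\<bar>diff_kernel k \<tau> (int n)\<bar> \<le> 2 ^ k * (?C / ?r * (\<tau> / ?r\<^sup>2) ^ k)"
    using \<tau> k n by (intro diff_kernel_le_sum B) auto
  thus ?thesis by simp
qed

text \<open>Here \<open>G(i \<tau>, n)\<close> is at most a constant times \<open>(1 / n) exp (- y)\<close> with \<open>y = n / (2 sqrt (k \<tau>))\<close>,
  and \<open>exp (- y)\<close> is bounded both by \<open>1\<close> and by \<open>(2 k)!\<close> divided by the \<open>2 k\<close>-th power of \<open>y\<close>,
  which is of order \<open>(\<tau> / n\<^sup>2)\<^sup>k\<close>.\<close>

lemma diff_kernel_large_time:
  assumes k: "k \<ge> 1" and n: "k \<le> n" and \<tau>: "\<tau> \<ge> 1"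
  shows "\<bar>diff_kernel k \<tau> (int n)\<bar> \<le>
           2 ^ k * (2 * exp 2 * (fact (2 * k) * (16 * real k) ^ k)) / (1 + real n) *
           min 1 (\<tau> / (1 + real n)\<^sup>2) ^ k"
proof -
  let ?r = "1 + real n"
  let ?A = "fact (2 * k) * (16 * real k) ^ k"
  have A1: "?A \<ge> 1"
  proof -
    have "(16 * real k) ^ k \<ge> 1" using k by (intro one_le_power) auto
    from mult_mono[OF fact_ge_1 this, of "2 * k"] show ?thesis by simp
  qed
  have E: "exp (- real n / (2 * sqrt (real k * \<tau>))) \<le> ?A * min 1 (\<tau> / ?r\<^sup>2) ^ k"
  proof -
    define y where "y = real n / (2 * sqrt (real k * \<tau>))"
    have y: "y > 0" using k n \<tau> by (simp add: y_def)
    have y2: "y\<^sup>2 = (real n)\<^sup>2 / (4 * (real k * \<tau>))"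
      using k \<tau> by (simp add: y_def power_divide power_mult_distrib)
    have "?r\<^sup>2 \<le> (2 * real n)\<^sup>2" using k n by (intro power_mono) auto
    hence "?r\<^sup>2 / (16 * (real k * \<tau>)) \<le> (2 * real n)\<^sup>2 / (16 * (real k * \<tau>))"
      using k \<tau> by (intro divide_right_mono) auto
    hence "?r\<^sup>2 / (16 * (real k * \<tau>)) \<le> y\<^sup>2" by (simp add: y2 mult_ac)
    hence "(?r\<^sup>2 / (16 * (real k * \<tau>))) ^ k \<le> y ^ (2 * k)"
      using k \<tau> unfolding power_mult by (intro power_mono) auto
    also have "\<dots> \<le> fact (2 * k) * exp y" using y by (intro power_le_fact_exp) auto
    finally have *: "(?r\<^sup>2 / (16 * (real k * \<tau>))) ^ k \<le> fact (2 * k) * exp y" .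
    have "exp (- y) * a \<le> b" if "a \<le> b * exp y" for a b
      using that by (simp add: exp_minus field_simps)
    from this[OF *] have "exp (- y) * (?r\<^sup>2 / (16 * (real k * \<tau>))) ^ k \<le> fact (2 * k)" .
    moreover have "(?r\<^sup>2 / (16 * (real k * \<tau>))) ^ k = 1 / ((16 * real k) ^ k * (\<tau> / ?r\<^sup>2) ^ k)"
      using k \<tau> by (simp add: power_divide power_mult_distrib)
    moreover have "(16 * real k) ^ k * (\<tau> / ?r\<^sup>2) ^ k > 0" using k \<tau>
      by (intro mult_pos_pos zero_less_power divide_pos_pos) auto
    ultimately have "exp (- y) \<le> ?A * (\<tau> / ?r\<^sup>2) ^ k" by (simp add: divide_le_eq mult_ac)
    moreover have "exp (- y) \<le> ?A * 1"
      using A1 y by (smt (verit) exp_le_one_iff)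
    ultimately show ?thesis using \<tau>
      by (subst min_power_right) (auto simp: y_def min_def)
  qed
  have B: "heat_kernel (real i * \<tau>) (int n) \<le> 2 * exp 2 * ?A / ?r * min 1 (\<tau> / ?r\<^sup>2) ^ k"
    if i: "1 \<le> i" "i \<le> k" for i
  proof -
    have i\<tau>: "real i * \<tau> \<ge> 1" using i \<tau> mult_mono[of 1 "real i" 1 \<tau>] by simp
    have "real n * heat_kernel (real i * \<tau>) (int n) \<le> exp 2 * exp (- real n / (2 * sqrt (real i * \<tau>)))"
      using i\<tau> by (rule heat_kernel_le_exp)
    also have "\<dots> \<le> exp 2 * exp (- real n / (2 * sqrt (real k * \<tau>)))"
    proof -
      have "sqrt (real i * \<tau>) \<le> sqrt (real k * \<tau>)" using i \<tau> by simp
      moreover have "sqrt (real i * \<tau>) > 0" using i\<tau> by simp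
      ultimately have "real n / (2 * sqrt (real k * \<tau>)) \<le> real n / (2 * sqrt (real i * \<tau>))"
        by (intro divide_left_mono mult_left_mono mult_pos_pos) auto
      thus ?thesis by simp
    qed
    also have "\<dots> \<le> exp 2 * (?A * min 1 (\<tau> / ?r\<^sup>2) ^ k)" using E by (intro mult_left_mono) auto
    finally have *: "real n * heat_kernel (real i * \<tau>) (int n) \<le> exp 2 * (?A * min 1 (\<tau> / ?r\<^sup>2) ^ k)" .
    have "?r * heat_kernel (real i * \<tau>) (int n) \<le> (2 * real n) * heat_kernel (real i * \<tau>) (int n)"
      using k n \<tau> by (intro mult_right_mono heat_kernel_nonneg) auto
    also have "\<dots> \<le> 2 * (exp 2 * (?A * min 1 (\<tau> / ?r\<^sup>2) ^ k))" using * by simp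
    finally show ?thesis by (simp add: field_simps)
  qed
  have "\<bar>diff_kernel k \<tau> (int n)\<bar> \<le> 2 ^ k * (2 * exp 2 * ?A / ?r * min 1 (\<tau> / ?r\<^sup>2) ^ k)"
    using \<tau> k n A1 by (intro diff_kernel_le_sum B) (auto intro!: mult_nonneg_nonneg)
  thus ?thesis by simp
qed

text \<open>The two regimes of the minimum are separated by the diffusive time \<open>\<tau> = (1 + |m|)\<^sup>2\<close>.\<close>

lemma diff_kernel_decay:
  assumes k: "k \<ge> 1"
  obtains C where "C > 0" "\<And>\<tau> m. \<tau> > 0 \<Longrightarrow> \<bar>diff_kernel k \<tau> m\<bar> \<le>
      C / (1 + \<bar>of_int m\<bar>) * min 1 (\<tau> / (1 + \<bar>of_int m\<bar>)\<^sup>2) ^ k"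
proof -
  define C1 where "C1 = (2 * real k) ^ (2 * k) * real k"
  define C2 :: real where "C2 = 2 ^ k * (fact (2 * k + 1) * exp 1 * exp (exp 1 * real k))"
  define C3 :: real where "C3 = 2 ^ k * (2 * exp 2 * (fact (2 * k) * (16 * real k) ^ k))"
  have pos: "C1 > 0" "C2 > 0" "C3 > 0" using k by (auto simp: C1_def C2_def C3_def)
  have main: "\<bar>diff_kernel k \<tau> (int n)\<bar> \<le> (C1 + C2 + C3) / (1 + real n) * min 1 (\<tau> / (1 + real n)\<^sup>2) ^ k"
    if \<tau>: "\<tau> > 0" for \<tau> n
  proof -
    let ?r = "1 + real n" and ?M = "min 1 (\<tau> / (1 + real n)\<^sup>2)"
    have M: "?M \<ge> 0" using \<tau> by simp
    have "\<exists>c\<in>{C1, C2, C3}. \<bar>diff_kernel k \<tau> (int n)\<bar> \<le> c / ?r * ?M ^ k"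
    proof (cases "k \<le> n")
      case False
      \<comment> \<open>Since \<open>1 + n \<le> k\<close>, all powers of \<open>1 + n\<close> can be absorbed into the constant.\<close>
      hence r: "?r \<le> real k" by linarith
      have "4 * \<tau> \<le> (2 * real k)\<^sup>2 * (\<tau> / ?r\<^sup>2)"
      proof -
        have "?r\<^sup>2 \<le> (real k)\<^sup>2" using r by (intro power_mono) auto
        hence "4 * \<tau> * ?r\<^sup>2 \<le> 4 * \<tau> * (real k)\<^sup>2" using \<tau> by (intro mult_left_mono) auto
        thus ?thesis by (simp add: field_simps)
      qed
      moreover have "1 \<le> (2 * real k)\<^sup>2 * 1"
      proof -
        have "1 \<le> 2 * real k" using k by simp
        from one_le_power[OF this, of 2] show ?thesis by simp
      qed
      moreover have "min 1 x \<le> a * min 1 b" if "x \<le> a * b" "1 \<le> a * 1" for x a b :: real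
        using that by (auto simp: min_def)
      ultimately have "min 1 (4 * \<tau>) \<le> (2 * real k)\<^sup>2 * ?M" by blast
      hence "min 1 (4 * \<tau>) ^ k \<le> ((2 * real k)\<^sup>2 * ?M) ^ k" using \<tau> by (intro power_mono) auto
      also have "\<dots> = (2 * real k) ^ (2 * k) * 1 * ?M ^ k" by (simp add: power_mult_distrib power_mult)
      also have "\<dots> \<le> (2 * real k) ^ (2 * k) * (real k / ?r) * ?M ^ k"
        using M r by (intro mult_mono zero_le_power) auto
      finally have "\<bar>diff_kernel k \<tau> (int n)\<bar> \<le> C1 / ?r * ?M ^ k"
        using diff_kernel_le[of \<tau> k "int n"] \<tau> by (simp add: C1_def)
      thus ?thesis by blast
    next
      case n: True
      show ?thesis
      proof (cases "\<tau> \<le> 1")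
        case True
        have "1 \<le> ?r\<^sup>2" by (simp add: one_le_power)
        hence "\<tau> \<le> ?r\<^sup>2" using True by linarith
        hence "?M = \<tau> / ?r\<^sup>2" by (intro min_absorb2) (simp add: divide_le_eq)
        thus ?thesis using diff_kernel_small_time[OF k n \<tau> True] by (auto simp: C2_def)
      next
        case False
        thus ?thesis using diff_kernel_large_time[OF k n, of \<tau>] by (auto simp: C3_def)
      qed
    qed
    then obtain c where c: "c \<in> {C1, C2, C3}" "\<bar>diff_kernel k \<tau> (int n)\<bar> \<le> c / ?r * ?M ^ k" by blast
    note c(2)
    also have "c / ?r * ?M ^ k \<le> (C1 + C2 + C3) / ?r * ?M ^ k"
      using c(1) pos M by (intro mult_right_mono divide_right_mono) auto
    finally show ?thesis .
  qed
  show ?thesis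
  proof (rule that[of "C1 + C2 + C3"])
    show "C1 + C2 + C3 > 0" using pos by simp
    fix \<tau> :: real and m :: int assume \<tau>: "\<tau> > 0"
    have "diff_kernel k \<tau> m = diff_kernel k \<tau> (int (nat \<bar>m\<bar>))"
      by (cases "m \<ge> 0") (auto simp: diff_kernel_minus)
    thus "\<bar>diff_kernel k \<tau> m\<bar> \<le> (C1 + C2 + C3) / (1 + \<bar>of_int m\<bar>) * min 1 (\<tau> / (1 + \<bar>of_int m\<bar>)\<^sup>2) ^ k"
      using main[OF \<tau>, of "nat \<bar>m\<bar>"] by simp
  qed
qed

section \<open>Integration against the fractional weight\<close>

lemma set_lborel_integrable_nonneg:
  fixes f :: "real \<Rightarrow> real"
  assumes "f integrable_on S" "\<And>x. x \<in> S \<Longrightarrow> f x \<ge> 0" "S \<in> sets borel" "f \<in> borel_measurable borel"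
  shows "set_integrable lborel S f"
proof -
  have "f absolutely_integrable_on S"
    using assms(1,2) by (rule nonnegative_absolutely_integrable_1)
  moreover have "(\<lambda>x. indicator S x *\<^sub>R f x) \<in> borel_measurable lborel"
    using assms(3,4) by simp
  ultimately show ?thesis
    unfolding set_integrable_def using integrable_completion by blast
qed

text \<open>Near \<open>0\<close> the integrand is \<open>\<tau>\<close> to the power \<open>k - 1 - \<beta>\<close>, near infinity it is \<open>\<tau>\<close> to the power
  \<open>-1 - \<beta>\<close>.\<close>

lemma set_integrable_cutoff:
  assumes \<beta>: "\<beta> > 0" "\<beta> < real k"
  shows "set_integrable lborel {0<..} (\<lambda>\<tau>. min 1 \<tau> ^ k / \<tau> powr (1 + \<beta>))"
proof -
  let ?f = "\<lambda>\<tau>::real. min 1 \<tau> ^ k / \<tau> powr (1 + \<beta>)"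
  have "set_integrable lborel {0<..1} (\<lambda>\<tau>. \<tau> powr (real k - 1 - \<beta>))"
    using \<beta> by (intro set_lborel_integrable_nonneg integrable_on_powr_from_0') auto
  also have "?this \<longleftrightarrow> set_integrable lborel {0<..1} ?f"
    by (intro set_integrable_cong refl) (auto simp: powr_diff powr_add powr_realpow)
  finally have 1: "set_integrable lborel {0<..1} ?f" .
  have "(\<lambda>\<tau>::real. \<tau> powr (- 1 - \<beta>)) integrable_on {1..}"
    using has_integral_powr_to_inf[of "- 1 - \<beta>" 1] \<beta> by (auto simp: integrable_on_def)
  hence "set_integrable lborel {1..} (\<lambda>\<tau>::real. \<tau> powr (- 1 - \<beta>))"
    by (intro set_lborel_integrable_nonneg) auto
  also have "?this \<longleftrightarrow> set_integrable lborel {1..} ?f"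
  proof (intro set_integrable_cong refl)
    fix \<tau> :: real assume "\<tau> \<in> {1..}"
    thus "\<tau> powr (- 1 - \<beta>) = ?f \<tau>"
      using powr_minus_divide[of \<tau> "1 + \<beta>"] by (simp add: min_absorb1)
  qed
  finally have 2: "set_integrable lborel {1..} ?f" .
  have "{0<..1} \<union> {1..} = {0::real<..}" by auto
  thus ?thesis using set_integrable_Un[OF 1 2] by simp
qed

text \<open>The substitution \<open>u = a \<tau>\<close>. It is used twice: with \<open>a = \<lambda>(\<theta>)\<close> to produce the \<open>\<beta>\<close>-th power of
  the symbol, and with \<open>a = 1 / (1 + |m|)\<^sup>2\<close> to read off the decay in \<open>m\<close>.\<close>

lemma weighted_integral_scaling:
  fixes h :: "real \<Rightarrow> real"
  assumes a: "a > 0"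
  shows "set_integrable lborel {0<..} (\<lambda>\<tau>. h (a * \<tau>) / \<tau> powr (1 + \<beta>)) \<longleftrightarrow>
         set_integrable lborel {0<..} (\<lambda>\<tau>. h \<tau> / \<tau> powr (1 + \<beta>))"
    and "(LBINT \<tau>:{0<..}. h (a * \<tau>) / \<tau> powr (1 + \<beta>)) =
         a powr \<beta> * (LBINT \<tau>:{0<..}. h \<tau> / \<tau> powr (1 + \<beta>))"
proof -
  define f where "f = (\<lambda>\<tau>. indicator {0<..} \<tau> *\<^sub>R (h \<tau> / \<tau> powr (1 + \<beta>)))"
  define g where "g = (\<lambda>\<tau>. indicator {0<..} \<tau> *\<^sub>R (h (a * \<tau>) / \<tau> powr (1 + \<beta>)))"
  have g: "g \<tau> = a powr (1 + \<beta>) * f (0 + a * \<tau>)" for \<tau>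
    using a by (auto simp: f_def g_def indicator_def powr_mult zero_less_mult_iff)
  have "integrable lborel (\<lambda>\<tau>. f (0 + a * \<tau>)) \<longleftrightarrow> integrable lborel f"
    using a by (intro lborel_integrable_real_affine_iff) auto
  moreover have "integrable lborel g \<longleftrightarrow> integrable lborel (\<lambda>\<tau>. f (0 + a * \<tau>))"
    unfolding g[abs_def] using a by simp
  ultimately show "set_integrable lborel {0<..} (\<lambda>\<tau>. h (a * \<tau>) / \<tau> powr (1 + \<beta>)) \<longleftrightarrow>
         set_integrable lborel {0<..} (\<lambda>\<tau>. h \<tau> / \<tau> powr (1 + \<beta>))"
    by (simp add: set_integrable_def f_def g_def)
  have "(\<integral>\<tau>. g \<tau> \<partial>lborel) = a powr (1 + \<beta>) * (\<integral>\<tau>. f (0 + a * \<tau>) \<partial>lborel)"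
    unfolding g[abs_def] by simp
  also have "a powr (1 + \<beta>) = a powr \<beta> * \<bar>a\<bar>" using a by (simp add: powr_add)
  also have "a powr \<beta> * \<bar>a\<bar> * (\<integral>\<tau>. f (0 + a * \<tau>) \<partial>lborel) = a powr \<beta> * (\<integral>\<tau>. f \<tau> \<partial>lborel)"
    using lborel_integral_real_affine[of a f 0] a by simp
  finally show "(LBINT \<tau>:{0<..}. h (a * \<tau>) / \<tau> powr (1 + \<beta>)) =
         a powr \<beta> * (LBINT \<tau>:{0<..}. h \<tau> / \<tau> powr (1 + \<beta>))"
    by (simp add: set_lebesgue_integral_def f_def g_def)
qed

lemma frac_order_bounds: "\<beta> > 0 \<Longrightarrow> \<beta> < real (frac_order \<beta>)" "frac_order \<beta> \<ge> 1"
  unfolding frac_order_def by linarith+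

lemma frac_const_integrable:
  assumes "\<beta> > 0"
  shows "set_integrable lborel {0<..} (\<lambda>\<tau>. (exp (- \<tau>) - 1) ^ frac_order \<beta> / \<tau> powr (1 + \<beta>))"
proof (rule set_integrable_bound[OF set_integrable_cutoff[OF assms frac_order_bounds(1)[OF assms]]])
  show "set_borel_measurable lborel {0<..} (\<lambda>\<tau>. (exp (- \<tau>) - 1) ^ frac_order \<beta> / \<tau> powr (1 + \<beta>))"
    unfolding set_borel_measurable_def by measurable
  have "\<bar>exp (- \<tau>) - 1\<bar> ^ frac_order \<beta> \<le> min 1 \<tau> ^ frac_order \<beta>" if "\<tau> > 0" for \<tau> :: real
    using abs_exp_minus_1_le[of \<tau>] that by (intro power_mono) auto
  thus "AE \<tau> in lborel. \<tau> \<in> {0<..} \<longrightarrow> norm ((exp (- \<tau>) - 1) ^ frac_order \<beta> / \<tau> powr (1 + \<beta>))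
        \<le> norm (min 1 \<tau> ^ frac_order \<beta> / \<tau> powr (1 + \<beta>))"
    by (auto simp: abs_mult power_abs intro!: divide_right_mono)
qed

text \<open>The integrand has the constant sign \<open>(-1)\<^sup>k\<close> on the positive half-line and vanishes nowhere
  there.\<close>

lemma frac_const_nonzero:
  assumes "\<beta> > 0"
  shows "frac_const \<beta> \<noteq> 0"
proof
  assume 0: "frac_const \<beta> = 0"
  let ?k = "frac_order \<beta>"
  define f where "f = (\<lambda>\<tau>. indicator {0<..} \<tau> *\<^sub>R ((exp (- \<tau>) - 1) ^ ?k / \<tau> powr (1 + \<beta>)) :: real)"
  define g where "g = (\<lambda>\<tau>. (- 1) ^ ?k * f \<tau>)"
  have g_eq: "g \<tau> = indicator {0<..} \<tau> * ((1 - exp (- \<tau>)) ^ ?k / \<tau> powr (1 + \<beta>))" for \<tau>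
    by (simp add: g_def f_def power_mult_distrib[symmetric])
  have f: "integrable lborel f"
    using frac_const_integrable[OF assms] by (simp add: set_integrable_def f_def)
  hence g: "integrable lborel g" unfolding g_def by simp
  have "(\<integral>\<tau>. g \<tau> \<partial>lborel) = 0"
  proof -
    have "(\<integral>\<tau>. f \<tau> \<partial>lborel) = 0"
      using 0 by (simp add: f_def frac_const_def set_lebesgue_integral_def)
    thus ?thesis unfolding g_def by simp
  qed
  moreover have "g \<tau> \<ge> 0" for \<tau> by (auto simp: g_eq indicator_def)
  ultimately have "AE \<tau> in lborel. g \<tau> = 0"
    using integral_nonneg_eq_0_iff_AE[OF g] by simp
  hence "AE \<tau> in lborel. \<tau> \<notin> {0<..<1::real}"
    by (rule eventually_mono) (auto simp: g_eq)
  hence "emeasure lborel {0<..<1::real} = 0"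
    by (subst AE_iff_measurable[symmetric, of _ _ "\<lambda>x. x \<notin> {0<..<1}"]) auto
  thus False by simp
qed

text \<open>At \<open>a = 0\<close> both sides vanish, as the order of the difference is positive.\<close>

lemma frac_const_scaling:
  assumes "a \<ge> 0" "\<beta> > 0"
  shows "(LBINT \<tau>:{0<..}. (exp (- \<tau> * a) - 1) ^ frac_order \<beta> / \<tau> powr (1 + \<beta>)) = a powr \<beta> * frac_const \<beta>"
proof (cases "a = 0")
  case True
  thus ?thesis using frac_order_bounds(2)[of \<beta>] by (simp add: zero_power set_lebesgue_integral_def)
next
  case False
  thus ?thesis using weighted_integral_scaling(2)[of a "\<lambda>\<tau>. (exp (- \<tau>) - 1) ^ frac_order \<beta>" \<beta>] assms
    by (simp add: frac_const_def mult.commute)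
qed

text \<open>Interchange the integrals over \<open>\<tau>\<close> and \<open>\<theta>\<close> and scale \<open>\<tau>\<close> by \<open>\<lambda>(\<theta>)\<close> for fixed \<open>\<theta>\<close>. The bound
  \<open>min(1, 4 \<tau>)\<^sup>k\<close> on the multiplier dominates the double integral.\<close>

lemma diff_kernel_weighted_integral:
  assumes \<beta>: "\<beta> > 0"
  shows "(LBINT \<tau>:{0<..}. diff_kernel (frac_order \<beta>) \<tau> m / \<tau> powr (1 + \<beta>)) =
         frac_const \<beta> * cos_coeff (\<lambda>\<theta>. symb \<theta> powr \<beta>) m"
proof -
  let ?k = "frac_order \<beta>"
  define g where "g = (\<lambda>\<tau>. indicator {0<..} \<tau> *\<^sub>R (min 1 (4 * \<tau>) ^ ?k / \<tau> powr (1 + \<beta>)) :: real)"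
  define h where "h = (\<lambda>\<theta>. indicator {0..pi} \<theta> :: real)"
  define F where "F = (\<lambda>\<tau> \<theta>. indicator {0<..} \<tau> * indicator {0..pi} \<theta> *
     ((exp (- \<tau> * symb \<theta>) - 1) ^ ?k * cos (of_int m * \<theta>) / \<tau> powr (1 + \<beta>)) :: real)"
  have [measurable]: "symb \<in> borel_measurable borel"
    by (intro borel_measurable_continuous_onI continuous_intros)
  have g: "integrable lborel g"
    using weighted_integral_scaling(1)[of 4 "\<lambda>\<tau>. min 1 \<tau> ^ ?k" \<beta>]
      set_integrable_cutoff[OF \<beta> frac_order_bounds(1)[OF \<beta>]]
    by (simp add: set_integrable_def g_def)
  have h: "integrable lborel h"
    unfolding h_def by (subst integrable_indicator_iff) auto
  have [measurable]: "g \<in> borel_measurable borel" "h \<in> borel_measurable borel"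
    unfolding g_def h_def by measurable
  have gh: "integrable (lborel \<Otimes>\<^sub>M lborel) (\<lambda>(\<tau>, \<theta>). g \<tau> * h \<theta>)"
    by (rule lborel_pair.Fubini_integrable) (use g h in \<open>auto simp: abs_mult\<close>)
  have "integrable (lborel \<Otimes>\<^sub>M lborel) (\<lambda>(\<tau>, \<theta>). F \<tau> \<theta>)"
  proof (rule Bochner_Integration.integrable_bound[OF gh])
    show "(\<lambda>(\<tau>, \<theta>). F \<tau> \<theta>) \<in> borel_measurable (lborel \<Otimes>\<^sub>M lborel)"
      unfolding F_def by measurable
    have "\<bar>F \<tau> \<theta>\<bar> \<le> \<bar>g \<tau> * h \<theta>\<bar>" for \<tau> \<theta>
    proof (cases "\<tau> > 0 \<and> \<theta> \<in> {0..pi}")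
      case True
      have "\<bar>(exp (- \<tau> * symb \<theta>) - 1) ^ ?k\<bar> * \<bar>cos (of_int m * \<theta>)\<bar> \<le> min 1 (4 * \<tau>) ^ ?k * 1"
        using True by (intro mult_mono exp_symb_diff_bound) auto
      hence "\<bar>(exp (- \<tau> * symb \<theta>) - 1) ^ ?k\<bar> * \<bar>cos (of_int m * \<theta>)\<bar> / \<tau> powr (1 + \<beta>) \<le>
        min 1 (4 * \<tau>) ^ ?k / \<tau> powr (1 + \<beta>)" by (intro divide_right_mono) auto
      thus ?thesis using True by (simp add: F_def g_def h_def abs_mult)
    qed (auto simp: F_def g_def h_def)
    thus "AE x in lborel \<Otimes>\<^sub>M lborel. norm (case x of (\<tau>, \<theta>) \<Rightarrow> F \<tau> \<theta>) \<le> norm (case x of (\<tau>, \<theta>) \<Rightarrow> g \<tau> * h \<theta>)"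
      by auto
  qed
  hence Fub: "(\<integral>\<theta>. (\<integral>\<tau>. F \<tau> \<theta> \<partial>lborel) \<partial>lborel) = (\<integral>\<tau>. (\<integral>\<theta>. F \<tau> \<theta> \<partial>lborel) \<partial>lborel)"
    by (rule lborel_pair.Fubini_integral)
  have 1: "(\<integral>\<tau>. F \<tau> \<theta> \<partial>lborel) =
      frac_const \<beta> * (indicator {0..pi} \<theta> *\<^sub>R (symb \<theta> powr \<beta> * cos (of_int m * \<theta>)))" for \<theta>
  proof -
    have "(\<integral>\<tau>. F \<tau> \<theta> \<partial>lborel) = indicator {0..pi} \<theta> * cos (of_int m * \<theta>) *
       (LBINT \<tau>:{0<..}. (exp (- \<tau> * symb \<theta>) - 1) ^ ?k / \<tau> powr (1 + \<beta>))"
      unfolding set_lebesgue_integral_def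
      by (subst integral_mult_right_zero[symmetric]) (simp add: F_def mult_ac)
    thus ?thesis unfolding frac_const_scaling[OF symb_bounds(1) \<beta>] by simp
  qed
  have 2: "(\<integral>\<theta>. F \<tau> \<theta> \<partial>lborel) =
      pi * (indicator {0<..} \<tau> *\<^sub>R (diff_kernel ?k \<tau> m / \<tau> powr (1 + \<beta>)))" for \<tau>
  proof -
    have "(\<integral>\<theta>. F \<tau> \<theta> \<partial>lborel) = indicator {0<..} \<tau> / \<tau> powr (1 + \<beta>) *
       (LBINT \<theta>:{0..pi}. (exp (- \<tau> * symb \<theta>) - 1) ^ ?k * cos (of_int m * \<theta>))"
      unfolding set_lebesgue_integral_def
      by (subst integral_mult_right_zero[symmetric]) (simp add: F_def mult_ac)
    thus ?thesis by (simp add: diff_kernel_def cos_coeff_def)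
  qed
  show ?thesis
    using Fub unfolding 1 2 integral_mult_right_zero
    by (simp add: cos_coeff_def set_lebesgue_integral_def field_simps)
qed

text \<open>Integration of \<open>diff_kernel_decay\<close> against the weight; scaling leaves a constant times
  \<open>1 / r\<close> times the \<open>\<beta>\<close>-th power of \<open>1 / r\<^sup>2\<close>, where \<open>r = 1 + |m|\<close>.\<close>

lemma diff_kernel_weighted_bound:
  assumes \<beta>: "\<beta> > 0"
  shows "set_integrable lborel {0<..} (\<lambda>\<tau>. diff_kernel (frac_order \<beta>) \<tau> m / \<tau> powr (1 + \<beta>))"
    and "\<exists>C>0. \<forall>m. (LBINT \<tau>:{0<..}. \<bar>diff_kernel (frac_order \<beta>) \<tau> m / \<tau> powr (1 + \<beta>)\<bar>) \<le>
           C / (1 + \<bar>of_int m\<bar>) powr (1 + 2 * \<beta>)"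
proof -
  let ?k = "frac_order \<beta>"
  let ?H = "\<lambda>m \<tau>. diff_kernel ?k \<tau> m / \<tau> powr (1 + \<beta>)"
  define I where "I = (LBINT \<tau>:{0<..}. min 1 \<tau> ^ ?k / \<tau> powr (1 + \<beta>))"
  note cut = set_integrable_cutoff[OF \<beta> frac_order_bounds(1)[OF \<beta>]]
  obtain C where C: "C > 0" "\<And>\<tau> m. \<tau> > 0 \<Longrightarrow> \<bar>diff_kernel ?k \<tau> m\<bar> \<le>
      C / (1 + \<bar>of_int m\<bar>) * min 1 (\<tau> / (1 + \<bar>of_int m\<bar>)\<^sup>2) ^ ?k"
    using diff_kernel_decay[OF frac_order_bounds(2)] by blast
  define D where "D = (\<lambda>m \<tau>. C / (1 + \<bar>of_int m\<bar>) * (min 1 (1 / (1 + \<bar>of_int m\<bar>)\<^sup>2 * \<tau>) ^ ?k / \<tau> powr (1 + \<beta>)))"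
  have a: "1 / (1 + \<bar>of_int m\<bar>)\<^sup>2 > (0::real)" for m :: int
    by (intro divide_pos_pos zero_less_power) auto
  have D_int: "set_integrable lborel {0<..} (D m)" for m
    unfolding D_def using weighted_integral_scaling(1)[OF a, where h = "\<lambda>\<tau>. min 1 \<tau> ^ ?k" and \<beta> = \<beta>] cut
    by (intro set_integrable_mult_right) blast
  have H_le: "\<bar>?H m \<tau>\<bar> \<le> D m \<tau>" if "\<tau> > 0" for m \<tau>
    using divide_right_mono[OF C(2)[OF that, of m], of "\<tau> powr (1 + \<beta>)"] that by (simp add: D_def)
  have meas: "set_borel_measurable lborel {0<..} (?H m)" for m
  proof -
    have "(\<lambda>\<tau>. indicator {0<..} \<tau> * diff_kernel ?k \<tau> m / \<tau> powr (1 + \<beta>)) \<in> borel_measurable borel"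
      by measurable
    thus ?thesis by (simp add: set_borel_measurable_def)
  qed
  have H_int: "set_integrable lborel {0<..} (?H m)" for m
  proof (rule set_integrable_bound[OF D_int[of m] meas])
    have "\<bar>?H m \<tau>\<bar> \<le> \<bar>D m \<tau>\<bar>" if "\<tau> > 0" for \<tau>
      using H_le[OF that, of m] by linarith
    thus "AE \<tau> in lborel. \<tau> \<in> {0<..} \<longrightarrow> norm (?H m \<tau>) \<le> norm (D m \<tau>)" by simp
  qed
  thus "set_integrable lborel {0<..} (?H m)" .
  have "I \<ge> 0" unfolding I_def set_lebesgue_integral_def
    by (intro Bochner_Integration.integral_nonneg) (auto simp: indicator_def)
  have "(LBINT \<tau>:{0<..}. \<bar>?H m \<tau>\<bar>) \<le> C * (I + 1) / (1 + \<bar>of_int m\<bar>) powr (1 + 2 * \<beta>)" for m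
  proof -
    let ?r = "1 + \<bar>of_int m\<bar> :: real"
    have "(LBINT \<tau>:{0<..}. \<bar>?H m \<tau>\<bar>) \<le> (LBINT \<tau>:{0<..}. D m \<tau>)"
      by (intro set_integral_mono set_integrable_abs H_int D_int H_le) auto
    also have "\<dots> = C / ?r * ((1 / ?r\<^sup>2) powr \<beta> * I)"
      unfolding D_def I_def
      using weighted_integral_scaling(2)[OF a, where h = "\<lambda>\<tau>. min 1 \<tau> ^ ?k" and \<beta> = \<beta>] by (simp only: set_integral_mult_right)
    also have "(1 / ?r\<^sup>2) powr \<beta> = 1 / ?r powr (2 * \<beta>)"
    proof -
      have "?r\<^sup>2 = ?r powr 2" by (subst powr_numeral) auto
      thus ?thesis by (simp add: powr_divide powr_powr del: powr_numeral)
    qed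
    also have "C / ?r * (1 / ?r powr (2 * \<beta>) * I) = C * I / ?r powr (1 + 2 * \<beta>)"
      by (simp add: powr_add)
    also have "\<dots> \<le> C * (I + 1) / ?r powr (1 + 2 * \<beta>)"
      using C by (intro divide_right_mono mult_left_mono) auto
    finally show ?thesis .
  qed
  moreover have "C * (I + 1) > 0" using C \<open>I \<ge> 0\<close> by simp
  ultimately show "\<exists>C>0. \<forall>m. (LBINT \<tau>:{0<..}. \<bar>?H m \<tau>\<bar>) \<le> C / (1 + \<bar>of_int m\<bar>) powr (1 + 2 * \<beta>)"
    by blast
qed

section \<open>Cosine coefficients of the powers of the symbol\<close>

text \<open>The reciprocal Gamma function is entire and vanishes at the poles of Gamma, so it absorbs the
  exceptional case in the definition of the kernel.\<close>

lemma frac_kernel_rGamma: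
  "frac_kernel \<beta> n = (- 1) ^ nat \<bar>n\<bar> * Gamma (2 * \<beta> + 1) *
     rGamma (1 + \<beta> + of_int \<bar>n\<bar>) * rGamma (1 + \<beta> - of_int \<bar>n\<bar>)"
proof (cases "real_of_int \<bar>n\<bar> - \<beta> - 1 \<in> \<nat>")
  case True
  then obtain k where "real_of_int \<bar>n\<bar> - \<beta> - 1 = real k" by (auto elim: Nats_cases)
  hence "1 + \<beta> - of_int \<bar>n\<bar> = - real k" by linarith
  hence "rGamma (1 + \<beta> - of_int \<bar>n\<bar>) = 0" by (simp add: rGamma_eq_zero_iff)
  thus ?thesis using True by (simp add: frac_kernel_def)
next
  case False
  thus ?thesis by (simp add: frac_kernel_def rGamma_inverse_Gamma divide_inverse)
qed

lemma frac_kernel_minus: "frac_kernel \<beta> (- n) = frac_kernel \<beta> n"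
  by (simp add: frac_kernel_def)

lemma frac_kernel_Suc:
  "(\<beta> + real m + 1) * frac_kernel \<beta> (int (Suc m)) = (real m - \<beta>) * frac_kernel \<beta> (int m)"
proof -
  have 1: "(\<beta> + real m + 1) * rGamma (1 + (1 + \<beta> + real m)) = rGamma (1 + \<beta> + real m)"
    using rGamma_plus1[of "1 + \<beta> + real m"] by (simp add: add_ac)
  have 2: "rGamma (\<beta> - real m) = (\<beta> - real m) * rGamma (1 + \<beta> - real m)"
    using rGamma_plus1[of "\<beta> - real m"] by (simp add: algebra_simps)
  have "(\<beta> + real m + 1) * frac_kernel \<beta> (int (Suc m)) =
     - ((- 1) ^ m * Gamma (2 * \<beta> + 1)) * ((\<beta> + real m + 1) * rGamma (1 + (1 + \<beta> + real m))) *
       rGamma (\<beta> - real m)"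
    unfolding frac_kernel_rGamma by (simp add: nat_add_distrib algebra_simps)
  also have "\<dots> = - ((- 1) ^ m * Gamma (2 * \<beta> + 1)) * rGamma (1 + \<beta> + real m) *
       ((\<beta> - real m) * rGamma (1 + \<beta> - real m))"
    by (simp only: 1 2)
  also have "\<dots> = (real m - \<beta>) * frac_kernel \<beta> (int m)"
    unfolding frac_kernel_rGamma by (simp add: algebra_simps)
  finally show ?thesis .
qed

lemma symb_eq_sin: "symb \<theta> = 4 * (sin (\<theta> / 2))\<^sup>2"
  using cos_double_sin[of "\<theta> / 2"] by (simp add: symb_def)

lemma continuous_on_symb_powr:
  assumes "\<beta> > 0" shows "continuous_on A (\<lambda>\<theta>. symb \<theta> powr \<beta>)"
  using assms symb_bounds by (intro continuous_on_powr' continuous_intros) auto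

lemma cos_coeff_minus: "cos_coeff \<phi> (- m) = cos_coeff \<phi> m"
  by (simp add: cos_coeff_def)

text \<open>With \<open>\<phi> = \<theta> / 2\<close>, the derivative of \<open>sin \<phi>\<close> to the power \<open>2 \<beta> + 1\<close> times \<open>cos ((2 m + 1) \<phi>)\<close>
  is, by the addition theorems, the \<open>\<beta>\<close>-th power of the symbol times
  \<open>(\<beta> + m + 1) cos ((m + 1) \<theta>) + (\<beta> - m) cos (m \<theta>)\<close>, up to a constant factor. The function vanishes at
  \<open>\<theta> = 0\<close> because of the sine and at \<open>\<theta> = \<pi>\<close> because of the cosine.\<close>

lemma cos_coeff_symb_powr_Suc:
  assumes \<beta>: "\<beta> > 0"
  shows "(\<beta> + real m + 1) * cos_coeff (\<lambda>\<theta>. symb \<theta> powr \<beta>) (int (Suc m)) =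
         (real m - \<beta>) * cos_coeff (\<lambda>\<theta>. symb \<theta> powr \<beta>) (int m)"
proof -
  let ?\<psi> = "\<lambda>\<theta>. symb \<theta> powr \<beta>"
  let ?c = "\<lambda>k \<theta>. ?\<psi> \<theta> * cos (of_int (int k) * \<theta>)"
  define q where "q = (\<lambda>\<theta>. (\<beta> + real m + 1) * ?c (Suc m) \<theta> + (\<beta> - real m) * ?c m \<theta>)"
  define \<Phi> where "\<Phi> = (\<lambda>\<theta>. 2 * 4 powr \<beta> * (sin (\<theta> / 2) powr (2 * \<beta> + 1) * cos ((2 * real m + 1) * (\<theta> / 2))))"
  have int: "set_integrable lborel {0..pi} (?c k)" for k
    by (rule cos_coeff_integrable[OF continuous_on_symb_powr[OF \<beta>]])
  have "(q has_integral (\<Phi> pi - \<Phi> 0)) {0..pi}"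
  proof (rule fundamental_theorem_of_calculus_interior)
    show "continuous_on {0..pi} \<Phi>"
      unfolding \<Phi>_def using \<beta>
      by (intro continuous_intros continuous_on_powr') (auto intro!: sin_ge_zero)
    fix \<theta> :: real assume \<theta>: "\<theta> \<in> {0<..<pi}"
    define s c a where "s = sin (\<theta> / 2)" and "c = cos (\<theta> / 2)" and "a = (2 * real m + 1) * (\<theta> / 2)"
    have s: "s > 0" using \<theta> by (auto simp: s_def intro!: sin_gt_zero)
    have "(\<Phi> has_real_derivative 2 * 4 powr \<beta> * ((2 * \<beta> + 1) * s powr (2 * \<beta>) * (c / 2) * cos a +
        s powr (2 * \<beta> + 1) * (- sin a * ((2 * real m + 1) / 2)))) (at \<theta>)"
      unfolding \<Phi>_def using s
      by (auto intro!: derivative_eq_intros simp: s_def c_def a_def)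
    also have "2 * 4 powr \<beta> * ((2 * \<beta> + 1) * s powr (2 * \<beta>) * (c / 2) * cos a +
        s powr (2 * \<beta> + 1) * (- sin a * ((2 * real m + 1) / 2))) =
        4 powr \<beta> * s powr (2 * \<beta>) * ((2 * \<beta> + 1) * (c * cos a) - (2 * real m + 1) * (s * sin a))"
      using s by (simp add: powr_add field_simps)
    also have "(2 * \<beta> + 1) * (c * cos a) - (2 * real m + 1) * (s * sin a) =
        (\<beta> + real m + 1) * cos (a + \<theta> / 2) + (\<beta> - real m) * cos (a - \<theta> / 2)"
      by (simp add: cos_add cos_diff s_def c_def algebra_simps)
    also have "a + \<theta> / 2 = of_int (int (Suc m)) * \<theta>" by (simp add: a_def field_simps)
    also have "a - \<theta> / 2 = of_int (int m) * \<theta>" by (simp add: a_def field_simps)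
    also have "4 powr \<beta> * s powr (2 * \<beta>) = ?\<psi> \<theta>"
    proof -
      have "s\<^sup>2 = s powr 2" using s by simp
      thus ?thesis unfolding symb_eq_sin s_def[symmetric]
        by (simp add: powr_mult powr_powr del: powr_numeral)
    qed
    finally show "(\<Phi> has_vector_derivative q \<theta>) (at \<theta>)"
      by (simp add: has_real_derivative_iff_has_vector_derivative q_def algebra_simps)
  qed simp
  moreover have "cos ((2 * real m + 1) * (pi / 2)) = 0"
  proof -
    have "cos (real m * pi + pi / 2) = 0" by (simp add: cos_add)
    also have "real m * pi + pi / 2 = (2 * real m + 1) * (pi / 2)" by (simp add: field_simps)
    finally show ?thesis .
  qed
  hence "\<Phi> pi - \<Phi> 0 = 0" by (simp add: \<Phi>_def)
  ultimately have "integral {0..pi} q = 0" by (simp add: integral_unique)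
  moreover have q_int: "set_integrable lborel {0..pi} q"
    unfolding q_def using int by (intro set_integral_add set_integrable_mult_right)
  ultimately have "(LBINT \<theta>:{0..pi}. q \<theta>) = 0"
    using set_borel_integral_eq_integral(2)[OF q_int] by simp
  also have "(LBINT \<theta>:{0..pi}. q \<theta>) =
     (\<beta> + real m + 1) * (LBINT \<theta>:{0..pi}. ?c (Suc m) \<theta>) + (\<beta> - real m) * (LBINT \<theta>:{0..pi}. ?c m \<theta>)"
    unfolding q_def using int
    by (subst set_integral_add) (auto intro!: set_integrable_mult_right simp del: of_nat_Suc)
  finally have "(\<beta> + real m + 1) * (LBINT \<theta>:{0..pi}. ?c (Suc m) \<theta>) =
      (real m - \<beta>) * (LBINT \<theta>:{0..pi}. ?c m \<theta>)"
    by (simp add: algebra_simps)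
  thus ?thesis by (simp add: cos_coeff_def del: of_nat_Suc)
qed

lemma Gamma_legendre_duplication_real:
  assumes "z > (0::real)"
  shows "Gamma z * Gamma (z + 1 / 2) = 2 powr (1 - 2 * z) * sqrt pi * Gamma (2 * z)"
proof -
  have *: "complex_of_real x \<notin> \<int>\<^sub>\<le>\<^sub>0" if "x > 0" for x
    using that by (auto elim!: nonpos_Ints_cases simp: complex_eq_iff)
  have "Gamma (complex_of_real z) * Gamma (complex_of_real (z + 1 / 2)) =
      complex_of_real (exp ((1 - 2 * z) * ln 2) * sqrt pi) * Gamma (complex_of_real (2 * z))"
    using Gamma_legendre_duplication[of "complex_of_real z"] *[of z] *[of "z + 1 / 2"] assms
    by (simp add: exp_of_real[symmetric])
  hence "complex_of_real (Gamma z * Gamma (z + 1 / 2)) =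
      complex_of_real (exp ((1 - 2 * z) * ln 2) * sqrt pi * Gamma (2 * z))"
    using Gamma_complex_of_real[of z] Gamma_complex_of_real[of "z + 1 / 2"] Gamma_complex_of_real[of "2 * z"]
    by simp
  thus ?thesis unfolding of_real_eq_iff by (simp add: powr_def)
qed

text \<open>The substitution \<open>x = (1 - cos \<theta>) / 2\<close>, whose derivative is \<open>sin \<theta> / 2 = sqrt (x (1 - x))\<close>, leads to
  the Beta integral.\<close>

lemma integral_symb_powr:
  assumes \<beta>: "\<beta> > 0"
  shows "integral {0..pi} (\<lambda>\<theta>. symb \<theta> powr \<beta>) = 4 powr \<beta> * Beta (\<beta> + 1 / 2) (1 / 2)"
proof -
  define f where "f = (\<lambda>x::real. x powr (\<beta> - 1 / 2) * (1 - x) powr (- 1 / 2))"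
  define g where "g = (\<lambda>\<theta>. symb \<theta> / 4)"
  have g_eq: "g \<theta> = (1 - cos \<theta>) / 2" for \<theta> by (simp add: g_def symb_def)
  have range: "0 < g \<theta>" "g \<theta> < 1" if "\<theta> \<in> {0<..<pi}" for \<theta>
    using cos_monotone_0_pi[of 0 \<theta>] cos_monotone_0_pi[of \<theta> pi] that by (auto simp: g_eq)
  have "\<beta> + 1 / 2 - 1 = \<beta> - 1 / 2" "1 / 2 - 1 = - 1 / (2::real)" by simp_all
  hence f: "(f has_integral Beta (\<beta> + 1 / 2) (1 / 2)) {0<..<1}"
    using has_integral_Beta_real[of "\<beta> + 1 / 2" "1 / 2"] \<beta>
    unfolding f_def has_integral_Icc_iff_Ioo by simp
  have "f absolutely_integrable_on {0<..<1}"
    by (rule nonnegative_absolutely_integrable_1) (use f in \<open>auto simp: f_def\<close>)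
  hence "f absolutely_integrable_on {0<..<1} \<and> integral {0<..<1} f = Beta (\<beta> + 1 / 2) (1 / 2)"
    using f by (simp add: integral_unique)
  also have "{0<..<1} = g ` {0<..<pi}"
  proof (intro equalityI subsetI)
    fix x :: real assume x: "x \<in> {0<..<1}"
    hence "x = g (arccos (1 - 2 * x))" by (simp add: g_eq)
    moreover have "0 < arccos (1 - 2 * x)" "arccos (1 - 2 * x) < pi"
      using x arccos_lt_bounded[of "1 - 2 * x"] by auto
    ultimately show "x \<in> g ` {0<..<pi}" by auto
  qed (use range in auto)
  finally have *: "f absolutely_integrable_on (g ` {0<..<pi}) \<and>
     integral (g ` {0<..<pi}) f = Beta (\<beta> + 1 / 2) (1 / 2)" .
  have "integral {0<..<pi} (\<lambda>\<theta>. \<bar>sin \<theta> / 2\<bar> * f (g \<theta>)) = Beta (\<beta> + 1 / 2) (1 / 2)"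
  proof (rule conjunct2[OF has_absolute_integral_change_of_variables_1'[THEN iffD2, OF _ _ _ *]])
    show "(g has_real_derivative sin \<theta> / 2) (at \<theta> within {0<..<pi})" for \<theta>
      unfolding g_eq[abs_def] by (auto intro!: derivative_eq_intros)
    show "inj_on g {0<..<pi}"
      by (auto intro!: inj_onI simp: g_eq intro: cos_inj_pi)
  qed simp
  also have "integral {0<..<pi} (\<lambda>\<theta>. \<bar>sin \<theta> / 2\<bar> * f (g \<theta>)) = integral {0<..<pi} (\<lambda>\<theta>. g \<theta> powr \<beta>)"
  proof (rule integral_cong)
    fix \<theta> :: real assume \<theta>: "\<theta> \<in> {0<..<pi}"
    define x where "x = g \<theta>"
    have x: "x > 0" "1 - x > 0" using range[OF \<theta>] by (auto simp: x_def)
    have "(sin \<theta> / 2)\<^sup>2 = x * (1 - x)"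
      using sin_cos_squared_add[of \<theta>]
      by (simp add: x_def g_eq power2_eq_square field_simps)
    hence "\<bar>sin \<theta> / 2\<bar> = sqrt (x * (1 - x))" by (metis real_sqrt_abs)
    also have "\<dots> = x powr (1 / 2) * (1 - x) powr (1 / 2)"
      using x by (simp add: powr_half_sqrt real_sqrt_mult)
    finally have "\<bar>sin \<theta> / 2\<bar> * f x =
        (x powr (1 / 2) * x powr (\<beta> - 1 / 2)) * ((1 - x) powr (1 / 2) * (1 - x) powr (- 1 / 2))"
      by (simp add: f_def)
    also have "\<dots> = x powr \<beta>" using x by (simp add: powr_add[symmetric])
    finally show "\<bar>sin \<theta> / 2\<bar> * f (g \<theta>) = g \<theta> powr \<beta>" by (simp add: x_def)
  qed
  also have "\<dots> = integral {0..pi} (\<lambda>\<theta>. g \<theta> powr \<beta>)"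
    by (simp add: integral_open_interval_real)
  also have "\<dots> = integral {0..pi} (\<lambda>\<theta>. symb \<theta> powr \<beta> / 4 powr \<beta>)"
    using symb_bounds by (simp add: g_def powr_divide)
  also have "\<dots> = integral {0..pi} (\<lambda>\<theta>. symb \<theta> powr \<beta>) / 4 powr \<beta>" by simp
  finally show ?thesis by (simp add: field_simps)
qed

text \<open>Legendre's duplication formula turns the Beta value into \<open>\<Gamma>(2 \<beta> + 1) / \<Gamma>(\<beta> + 1)\<^sup>2\<close>.\<close>

lemma cos_coeff_symb_powr_0:
  assumes \<beta>: "\<beta> > 0"
  shows "cos_coeff (\<lambda>\<theta>. symb \<theta> powr \<beta>) 0 = frac_kernel \<beta> 0"
proof -
  have i: "set_integrable lborel {0..pi} (\<lambda>\<theta>. symb \<theta> powr \<beta>)"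
    using continuous_on_symb_powr[OF \<beta>] by (rule borel_integrable_atLeastAtMost')
  have "cos_coeff (\<lambda>\<theta>. symb \<theta> powr \<beta>) 0 = 1 / pi * integral {0..pi} (\<lambda>\<theta>. symb \<theta> powr \<beta>)"
    using set_borel_integral_eq_integral(2)[OF i] by (simp add: cos_coeff_def)
  also have "\<dots> = 4 powr \<beta> / pi * (Gamma (\<beta> + 1 / 2) * sqrt pi / Gamma (\<beta> + 1))"
  proof -
    have "\<beta> + 1 / 2 + 1 / 2 = \<beta> + 1" by simp
    thus ?thesis unfolding integral_symb_powr[OF \<beta>] Beta_def
      by (simp only: Gamma_one_half_real) simp
  qed
  also have "Gamma (\<beta> + 1 / 2) = 2 powr (- 2 * \<beta>) * sqrt pi * Gamma (2 * \<beta> + 1) / Gamma (\<beta> + 1)"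
  proof -
    have "Gamma (\<beta> + 1) > 0" using \<beta> by (intro Gamma_real_pos) auto
    moreover have "\<beta> + 1 / 2 + 1 / 2 = \<beta> + 1" "2 * (\<beta> + 1 / 2) = 2 * \<beta> + 1" "1 - (2 * \<beta> + 1) = - 2 * \<beta>"
      by simp_all
    with Gamma_legendre_duplication_real[of "\<beta> + 1 / 2"] \<beta>
    have "Gamma (\<beta> + 1 / 2) * Gamma (\<beta> + 1) = 2 powr (- 2 * \<beta>) * sqrt pi * Gamma (2 * \<beta> + 1)"
      by simp
    ultimately show ?thesis by (simp add: nonzero_eq_divide_eq)
  qed
  also have "4 powr \<beta> = 2 powr (2 * \<beta>)"
    using powr_powr[of 2 2 \<beta>] by simp
  also have "2 powr (2 * \<beta>) / pi * (2 powr (- 2 * \<beta>) * sqrt pi * Gamma (2 * \<beta> + 1) / Gamma (\<beta> + 1) *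
      sqrt pi / Gamma (\<beta> + 1)) =
      (2 powr (2 * \<beta>) * 2 powr (- 2 * \<beta>)) * (sqrt pi * sqrt pi / pi) * Gamma (2 * \<beta> + 1) / (Gamma (\<beta> + 1) * Gamma (\<beta> + 1))"
    by (simp only: times_divide_eq_right times_divide_eq_left divide_divide_eq_left mult_ac)
  also have "2 powr (2 * \<beta>) * 2 powr (- 2 * \<beta>) = (1::real)"
    by (simp add: powr_add[symmetric])
  also have "sqrt pi * sqrt pi / pi = 1" by simp
  also have "1 * 1 * Gamma (2 * \<beta> + 1) / (Gamma (\<beta> + 1) * Gamma (\<beta> + 1)) = frac_kernel \<beta> 0"
    by (simp add: frac_kernel_rGamma rGamma_inverse_Gamma divide_inverse add.commute)
  finally show ?thesis .
qed

text \<open>Both sides satisfy the same first-order recurrence in \<open>m \<ge> 0\<close>, whose leading coefficient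
  \<open>\<beta> + m + 1\<close> never vanishes, and both are even in \<open>m\<close>.\<close>

lemma cos_coeff_symb_powr:
  assumes \<beta>: "\<beta> > 0"
  shows "cos_coeff (\<lambda>\<theta>. symb \<theta> powr \<beta>) m = frac_kernel \<beta> m"
proof -
  have nat: "cos_coeff (\<lambda>\<theta>. symb \<theta> powr \<beta>) (int m) = frac_kernel \<beta> (int m)" for m
  proof (induction m)
    case 0
    show ?case using cos_coeff_symb_powr_0[OF \<beta>] by simp
  next
    case (Suc m)
    have "(\<beta> + real m + 1) * cos_coeff (\<lambda>\<theta>. symb \<theta> powr \<beta>) (int (Suc m)) =
        (\<beta> + real m + 1) * frac_kernel \<beta> (int (Suc m))"
      unfolding cos_coeff_symb_powr_Suc[OF \<beta>] frac_kernel_Suc Suc ..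
    thus ?case using \<beta> by simp
  qed
  show ?thesis
    using nat[of "nat \<bar>m\<bar>"] by (cases "m \<ge> 0") (auto simp: cos_coeff_minus frac_kernel_minus)
qed

section \<open>Kernels acting on sequences of exponential growth\<close>

text \<open>Kernels with a finite exponential moment of rate \<open>1\<close> act on sequences of growth at most
  \<open>exp |j|\<close>. This pair of classes is stable under convolution, contains the heat kernel, and its
  sequences include all of \<open>\<ell>\<^sub>\<beta>\<close> for every \<open>\<beta>\<close>, so the iteration of the operator can be carried out
  without tracking weights.\<close>

definition exp_kernel :: "(int \<Rightarrow> real) \<Rightarrow> bool" where
  "exp_kernel h \<longleftrightarrow> (\<lambda>m. \<bar>h m\<bar> * exp (real_of_int \<bar>m\<bar>)) summable_on UNIV"

definition exp_growth :: "(int \<Rightarrow> real) \<Rightarrow> bool" where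
  "exp_growth f \<longleftrightarrow> (\<exists>D. \<forall>j. \<bar>f j\<bar> \<le> D * exp (real_of_int \<bar>j\<bar>))"

lemma summable_on_abs_iff: "(\<lambda>x. \<bar>f x :: real\<bar>) summable_on A \<longleftrightarrow> f summable_on A"
  using summable_on_iff_abs_summable_on_real[of f A] by simp

lemma summable_on_finite_sum:
  fixes f :: "'i \<Rightarrow> 'a \<Rightarrow> real"
  assumes "finite I" "\<And>i. i \<in> I \<Longrightarrow> f i summable_on A"
  shows "(\<lambda>x. \<Sum>i\<in>I. f i x) summable_on A"
  using assms by (induction I) (auto intro: summable_on_add)

lemma has_sum_diff_real:
  fixes f g :: "'a \<Rightarrow> real"
  assumes "(f has_sum a) A" "(g has_sum b) A"
  shows "((\<lambda>x. f x - g x) has_sum (a - b)) A"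
  using has_sum_add[OF assms(1) has_sum_uminusI[OF assms(2)]] by simp

lemma exp_kernel_heat_kernel:
  assumes "t \<ge> 0" shows "exp_kernel (heat_kernel t)"
  unfolding exp_kernel_def
proof (rule summable_on_comparison_test)
  show "(\<lambda>m. heat_kernel t m * exp (1 * of_int m) + heat_kernel t m * exp (- 1 * of_int m)) summable_on UNIV"
    using heat_kernel_exp_has_sum[of t 1] heat_kernel_exp_has_sum[of t "- 1"]
    by (intro summable_on_add) (auto simp: summable_on_def)
  fix m :: int
  have "exp (real_of_int \<bar>m\<bar>) \<le> exp (1 * of_int m) + exp (- 1 * of_int m)"
    by (cases "m \<ge> 0") auto
  thus "\<bar>heat_kernel t m\<bar> * exp (real_of_int \<bar>m\<bar>) \<le>
      heat_kernel t m * exp (1 * of_int m) + heat_kernel t m * exp (- 1 * of_int m)"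
    using heat_kernel_nonneg[OF assms, of m] by (simp add: distrib_left[symmetric] mult_left_mono)
qed auto

lemma exp_kernel_diff_kernel:
  assumes "\<tau> \<ge> 0" shows "exp_kernel (diff_kernel k \<tau>)"
  unfolding exp_kernel_def
proof (rule summable_on_comparison_test)
  show "(\<lambda>m. \<Sum>i\<le>k. real (k choose i) * (\<bar>heat_kernel (real i * \<tau>) m\<bar> * exp (real_of_int \<bar>m\<bar>))) summable_on UNIV"
    using assms exp_kernel_heat_kernel unfolding exp_kernel_def
    by (intro summable_on_finite_sum summable_on_cmult_right) auto
  fix m
  have "\<bar>diff_kernel k \<tau> m\<bar> \<le> (\<Sum>i\<le>k. real (k choose i) * \<bar>heat_kernel (real i * \<tau>) m\<bar>)"
    unfolding diff_kernel_eq_sum[OF assms]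
    by (intro order_trans[OF sum_abs] sum_mono) (simp add: abs_mult)
  from mult_right_mono[OF this, of "exp (real_of_int \<bar>m\<bar>)"]
  show "\<bar>diff_kernel k \<tau> m\<bar> * exp (real_of_int \<bar>m\<bar>) \<le>
      (\<Sum>i\<le>k. real (k choose i) * (\<bar>heat_kernel (real i * \<tau>) m\<bar> * exp (real_of_int \<bar>m\<bar>)))"
    by (simp add: sum_distrib_right mult.assoc)
qed auto

lemma bij_betw_int_reflect: "bij_betw (\<lambda>j. n - j) UNIV (UNIV :: int set)"
  by (rule bij_betwI[of _ _ _ "\<lambda>j. n - j"]) auto

lemma exp_kernel_apply:
  assumes h: "exp_kernel h" and f: "\<And>j. \<bar>f j\<bar> \<le> D * exp (real_of_int \<bar>j\<bar>)"
  shows "(\<lambda>j. \<bar>h (n - j) * f j\<bar>) summable_on UNIV"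
    and "(\<Sum>\<^sub>\<infinity>j. \<bar>h (n - j) * f j\<bar>) \<le> (D * (\<Sum>\<^sub>\<infinity>m. \<bar>h m\<bar> * exp (real_of_int \<bar>m\<bar>))) * exp (real_of_int \<bar>n\<bar>)"
proof -
  let ?g = "\<lambda>m. \<bar>h m\<bar> * exp (real_of_int \<bar>m\<bar>)"
  let ?G = "\<lambda>j. D * exp (real_of_int \<bar>n\<bar>) * ?g (n - j)"
  have D: "D \<ge> 0" using f[of 0] by simp
  have "(\<lambda>j. ?g (n - j)) summable_on UNIV"
    using h summable_on_reindex_bij_betw[OF bij_betw_int_reflect, of ?g n] by (simp add: exp_kernel_def)
  hence sum: "?G summable_on UNIV" by (rule summable_on_cmult_right)
  have le: "\<bar>h (n - j) * f j\<bar> \<le> ?G j" for j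
  proof -
    have "\<bar>f j\<bar> \<le> D * exp (real_of_int \<bar>j\<bar>)" by (rule f)
    also have "\<dots> \<le> D * exp (real_of_int \<bar>n\<bar> + real_of_int \<bar>n - j\<bar>)"
      using D by (intro mult_left_mono) auto
    finally have "\<bar>h (n - j)\<bar> * \<bar>f j\<bar> \<le> \<bar>h (n - j)\<bar> * (D * exp (real_of_int \<bar>n\<bar> + real_of_int \<bar>n - j\<bar>))"
      by (intro mult_left_mono) auto
    thus ?thesis by (simp add: abs_mult exp_add mult_ac)
  qed
  show s: "(\<lambda>j. \<bar>h (n - j) * f j\<bar>) summable_on UNIV"
    by (rule summable_on_comparison_test[OF sum]) (use le in auto)
  have "(\<Sum>\<^sub>\<infinity>j. \<bar>h (n - j) * f j\<bar>) \<le> (\<Sum>\<^sub>\<infinity>j. ?G j)"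
    by (rule infsum_mono[OF s sum]) (rule le)
  also have "\<dots> = D * exp (real_of_int \<bar>n\<bar>) * (\<Sum>\<^sub>\<infinity>j. ?g (n - j))"
    by (rule infsum_cmult_right')
  also have "(\<Sum>\<^sub>\<infinity>j. ?g (n - j)) = (\<Sum>\<^sub>\<infinity>m. ?g m)"
    by (rule infsum_reindex_bij_betw[OF bij_betw_int_reflect])
  finally show "(\<Sum>\<^sub>\<infinity>j. \<bar>h (n - j) * f j\<bar>) \<le> (D * (\<Sum>\<^sub>\<infinity>m. ?g m)) * exp (real_of_int \<bar>n\<bar>)"
    by (simp add: mult_ac)
qed

lemma exp_kernel_summable:
  assumes "exp_kernel h" "exp_growth f"
  shows "(\<lambda>j. h (n - j) * f j) summable_on UNIV"
proof -
  obtain D where "\<And>j. \<bar>f j\<bar> \<le> D * exp (real_of_int \<bar>j\<bar>)" using assms(2) by (auto simp: exp_growth_def)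
  from exp_kernel_apply(1)[OF assms(1) this, of n] show ?thesis
    by (simp only: summable_on_abs_iff)
qed

lemma exp_growth_conv_abs:
  assumes "exp_kernel h" "exp_growth f"
  shows "exp_growth (\<lambda>n. \<Sum>\<^sub>\<infinity>j. \<bar>h (n - j) * f j\<bar>)"
proof -
  obtain D where "\<And>j. \<bar>f j\<bar> \<le> D * exp (real_of_int \<bar>j\<bar>)" using assms(2) by (auto simp: exp_growth_def)
  from exp_kernel_apply(2)[OF assms(1) this] show ?thesis
    unfolding exp_growth_def by (auto simp: infsum_nonneg intro!: exI)
qed

text \<open>Associativity of convolution; the kernel \<open>c\<close> stands for the convolution of \<open>g\<close> and \<open>h\<close>, shifted
  by \<open>n\<close>.\<close>

lemma exp_kernel_assoc:
  assumes g: "exp_kernel g" and h: "exp_kernel h" and f: "exp_growth f"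
    and F: "\<And>j. ((\<lambda>l. h (j - l) * f l) has_sum F j) UNIV"
    and c: "\<And>l. ((\<lambda>j. g (n - j) * h (j - l)) has_sum c l) UNIV"
  shows "((\<lambda>l. c l * f l) has_sum (\<Sum>\<^sub>\<infinity>j. g (n - j) * F j)) UNIV"
proof -
  let ?P = "\<lambda>(j, l). g (n - j) * (h (j - l) * f l)"
  have "(\<lambda>p. norm (?P p)) summable_on UNIV \<times> UNIV"
    unfolding Infinite_Sum.abs_summable_on_Sigma_iff
  proof (intro conjI ballI)
    fix j
    show "(\<lambda>l. norm (?P (j, l))) summable_on UNIV"
      using summable_on_cmult_right[OF exp_kernel_summable[OF h f, of j], of "g (n - j)"]
      by (simp add: summable_on_abs_iff)
    have "(\<lambda>j. g (n - j) * (\<Sum>\<^sub>\<infinity>l. \<bar>h (j - l) * f l\<bar>)) summable_on UNIV"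
      by (intro exp_kernel_summable[OF g] exp_growth_conv_abs h f)
    hence "(\<lambda>j. \<bar>g (n - j) * (\<Sum>\<^sub>\<infinity>l. \<bar>h (j - l) * f l\<bar>)\<bar>) summable_on UNIV"
      by (simp only: summable_on_abs_iff)
    moreover have "norm (\<Sum>\<^sub>\<infinity>l. norm (?P (j, l))) = \<bar>g (n - j) * (\<Sum>\<^sub>\<infinity>l. \<bar>h (j - l) * f l\<bar>)\<bar>" for j
      by (simp add: abs_mult infsum_cmult_right')
    ultimately show "(\<lambda>j. norm (\<Sum>\<^sub>\<infinity>l. norm (?P (j, l)))) summable_on UNIV"
      by simp
  qed
  hence P: "(?P has_sum (\<Sum>\<^sub>\<infinity>p. ?P p)) (UNIV \<times> UNIV)"
    using abs_summable_summable has_sum_infsum by fastforce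
  have "((\<lambda>j. g (n - j) * F j) has_sum (\<Sum>\<^sub>\<infinity>p. ?P p)) UNIV"
    by (rule has_sum_SigmaD[OF P]) (auto intro: has_sum_cmult_right F)
  hence eq: "(\<Sum>\<^sub>\<infinity>j. g (n - j) * F j) = (\<Sum>\<^sub>\<infinity>p. ?P p)" by (rule infsumI)
  have "((\<lambda>(l, j). ?P (j, l)) has_sum (\<Sum>\<^sub>\<infinity>p. ?P p)) (UNIV \<times> UNIV)"
    using P by (subst (asm) has_sum_swap) simp
  hence "((\<lambda>l. c l * f l) has_sum (\<Sum>\<^sub>\<infinity>p. ?P p)) UNIV"
  proof (rule has_sum_SigmaD)
    show "((\<lambda>j. case (l, j) of (l, j) \<Rightarrow> ?P (j, l)) has_sum c l * f l) UNIV" for l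
      using has_sum_cmult_left[OF c[of l], of "f l"] by (simp add: mult.assoc)
  qed
  thus ?thesis by (simp add: eq)
qed

text \<open>Each further application of the heat difference convolves with \<open>G(\<tau>, _)\<close> and subtracts, which
  takes the kernel of order \<open>i\<close> to that of order \<open>i + 1\<close>.\<close>

lemma heat_diff_funpow_has_sum:
  assumes \<tau>: "\<tau> > 0" and f: "exp_growth f"
  shows "((\<lambda>j. diff_kernel i \<tau> (n - j) * f j) has_sum (heat_diff \<tau> ^^ i) f n) UNIV"
proof (induction i arbitrary: n)
  case 0
  have "((\<lambda>j. if j = n then f n else 0) has_sum f n) UNIV"
    by (rule has_sum_finite_neutralI[of "{n}"]) auto
  also have "(\<lambda>j. if j = n then f n else 0) = (\<lambda>j. diff_kernel 0 \<tau> (n - j) * f j)"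
    by (auto simp: diff_kernel_0)
  finally show ?case by simp
next
  case (Suc i)
  let ?F = "(heat_diff \<tau> ^^ i) f"
  have "((\<lambda>l. (diff_kernel (Suc i) \<tau> (n - l) + diff_kernel i \<tau> (n - l)) * f l) has_sum
      (\<Sum>\<^sub>\<infinity>j. heat_kernel \<tau> (n - j) * ?F j)) UNIV"
  proof (rule exp_kernel_assoc[OF _ _ f Suc])
    fix l
    have bij: "bij_betw (\<lambda>j. j - l) UNIV (UNIV :: int set)"
      by (rule bij_betwI[of _ _ _ "\<lambda>j. j + l"]) auto
    have "((\<lambda>j. heat_kernel \<tau> (n - l - j) * diff_kernel i \<tau> j) has_sum
        diff_kernel (Suc i) \<tau> (n - l) + diff_kernel i \<tau> (n - l)) UNIV"
      using \<tau> by (intro diff_kernel_Suc_has_sum) auto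
    thus "((\<lambda>j. heat_kernel \<tau> (n - j) * diff_kernel i \<tau> (j - l)) has_sum
        diff_kernel (Suc i) \<tau> (n - l) + diff_kernel i \<tau> (n - l)) UNIV"
      using has_sum_reindex_bij_betw[OF bij, of "\<lambda>j. heat_kernel \<tau> (n - l - j) * diff_kernel i \<tau> j"]
      by simp
  qed (use \<tau> in \<open>auto intro: exp_kernel_heat_kernel exp_kernel_diff_kernel\<close>)
  from has_sum_diff_real[OF this Suc[of n]]
  have "((\<lambda>j. diff_kernel (Suc i) \<tau> (n - j) * f j) has_sum
      (\<Sum>\<^sub>\<infinity>j. heat_kernel \<tau> (n - j) * ?F j) - ?F n) UNIV"
    by (simp add: algebra_simps)
  also have "(\<Sum>\<^sub>\<infinity>j. heat_kernel \<tau> (n - j) * ?F j) - ?F n = (heat_diff \<tau> ^^ Suc i) f n"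
    by (simp add: heat_diff_def[of \<tau> ?F] heat_semigroup_def)
  finally show ?case .
qed

lemma exp_growth_heat_diff_funpow:
  assumes "\<tau> > 0" "exp_growth f"
  shows "exp_growth ((heat_diff \<tau> ^^ i) f)"
proof -
  have ek: "exp_kernel (diff_kernel i \<tau>)" using assms by (intro exp_kernel_diff_kernel) auto
  let ?S = "\<lambda>n. \<Sum>\<^sub>\<infinity>j. \<bar>diff_kernel i \<tau> (n - j) * f j\<bar>"
  have le: "\<bar>(heat_diff \<tau> ^^ i) f n\<bar> \<le> ?S n" for n
  proof -
    have "(\<lambda>j. \<bar>diff_kernel i \<tau> (n - j) * f j\<bar>) summable_on UNIV"
      using exp_kernel_summable[OF ek assms(2), of n] by (simp only: summable_on_abs_iff)
    thus ?thesis
      using norm_infsum_bound[of "\<lambda>j. diff_kernel i \<tau> (n - j) * f j" UNIV]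
        infsumI[OF heat_diff_funpow_has_sum[OF assms, of i n]] by simp
  qed
  obtain D where D: "\<And>n. \<bar>?S n\<bar> \<le> D * exp (real_of_int \<bar>n\<bar>)"
    using exp_growth_conv_abs[OF ek assms(2)] unfolding exp_growth_def by blast
  have "\<bar>(heat_diff \<tau> ^^ i) f n\<bar> \<le> D * exp (real_of_int \<bar>n\<bar>)" for n
    using le[of n] D[of n] by linarith
  thus ?thesis unfolding exp_growth_def by blast
qed

section \<open>The fractional Laplacian on weighted sequences\<close>

lemma ell_exp_growth:
  assumes f: "f \<in> ell \<beta>"
  shows "exp_growth f"
proof -
  let ?p = "1 + 2 * \<beta>"
  let ?u = "\<lambda>m. \<bar>f m\<bar> / (1 + real_of_int \<bar>m\<bar>) powr ?p"
  define N where "N = nat \<lceil>?p\<rceil>"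
  have u: "?u summable_on UNIV" using f by (simp add: ell_def)
  have "\<bar>f m\<bar> \<le> (infsum ?u UNIV * fact N * exp 1) * exp (real_of_int \<bar>m\<bar>)" for m
  proof -
    let ?r = "1 + real_of_int \<bar>m\<bar>"
    have "sum ?u {m} \<le> infsum ?u UNIV"
      by (rule finite_sum_le_infsum) (use u in auto)
    hence le: "\<bar>f m\<bar> \<le> infsum ?u UNIV * ?r powr ?p" by (simp add: divide_le_eq)
    have "?r powr ?p \<le> ?r powr real N"
      by (intro powr_mono) (auto simp: N_def intro: real_nat_ceiling_ge)
    moreover have "?r powr real N = ?r ^ N" by (intro powr_realpow) auto
    moreover have "?r ^ N \<le> fact N * exp ?r" by (intro power_le_fact_exp) auto
    ultimately have "?r powr ?p \<le> fact N * exp ?r" by linarith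
    hence "infsum ?u UNIV * ?r powr ?p \<le> infsum ?u UNIV * (fact N * exp ?r)"
      by (intro mult_left_mono infsum_nonneg) auto
    with le show ?thesis by (simp add: exp_add mult_ac)
  qed
  thus ?thesis unfolding exp_growth_def by blast
qed

text \<open>For \<open>p \<ge> 1\<close> the numbers \<open>1 / (1 + x)\<close> and \<open>x / (1 + x)\<close> add up to \<open>1\<close> and decrease when raised
  to the power \<open>p\<close>. Together with the next lemma this makes \<open>1 + x powr p\<close> and \<open>(1 + x) powr p\<close>
  interchangeable as weights.\<close>

lemma one_plus_powr_le:
  assumes "x \<ge> (0::real)" "p \<ge> 1"
  shows "1 + x powr p \<le> (1 + x) powr p"
proof -
  define y where "y = 1 / (1 + x)"
  have y: "0 < y" "y \<le> 1" "0 \<le> x * y" "x * y \<le> 1" "y + x * y = 1"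
    using assms by (auto simp: y_def field_simps)
  have le: "z powr p \<le> z" if "0 \<le> z" "z \<le> 1" for z :: real
    using powr_mono'[of 1 p z] that assms by simp
  have "y powr p + (x * y) powr p \<le> y + x * y" using y by (intro add_mono le) auto
  hence "(1 + x powr p) * y powr p \<le> 1" using y assms by (simp add: powr_mult algebra_simps)
  moreover have "y powr p = 1 / (1 + x) powr p" using assms by (simp add: y_def powr_divide)
  ultimately show ?thesis using assms by (simp add: divide_le_eq)
qed

lemma powr_le_one_plus:
  assumes "x \<ge> (0::real)" "p \<ge> 1"
  shows "(1 + x) powr p \<le> 2 powr p * (1 + x powr p)"
proof (cases "x \<le> 1")
  case True
  hence "(1 + x) powr p \<le> 2 powr p * 1" using assms by (simp add: powr_mono2)
  also have "\<dots> \<le> 2 powr p * (1 + x powr p)" by (intro mult_left_mono) auto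
  finally show ?thesis .
next
  case False
  hence "(1 + x) powr p \<le> (2 * x) powr p" using assms by (intro powr_mono2) auto
  also have "\<dots> = 2 powr p * x powr p" using assms by (simp add: powr_mult)
  also have "\<dots> \<le> 2 powr p * (1 + x powr p)" by (intro mult_left_mono) auto
  finally show ?thesis .
qed

text \<open>Translating the weight costs at most a constant that depends on \<open>n\<close>, since
  \<open>1 + |j| \<le> (1 + |n|) (1 + |n - j|)\<close>.\<close>

lemma ell_shift_summable:
  assumes \<beta>: "\<beta> > 0" and f: "f \<in> ell \<beta>"
  shows "(\<lambda>j. \<bar>f j\<bar> / (1 + real_of_int \<bar>n - j\<bar>) powr (1 + 2 * \<beta>)) summable_on UNIV"
proof (rule summable_on_comparison_test)
  let ?p = "1 + 2 * \<beta>"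
  show "(\<lambda>j. (1 + real_of_int \<bar>n\<bar>) powr ?p * (\<bar>f j\<bar> / (1 + real_of_int \<bar>j\<bar>) powr ?p)) summable_on UNIV"
    using f unfolding ell_def by (intro summable_on_cmult_right) simp
  fix j
  have "1 + real_of_int \<bar>j\<bar> \<le> 1 + real_of_int \<bar>n\<bar> + real_of_int \<bar>n - j\<bar>" by simp
  also have "\<dots> \<le> (1 + real_of_int \<bar>n\<bar>) * (1 + real_of_int \<bar>n - j\<bar>)"
    by (simp add: distrib_left distrib_right)
  finally have "(1 + real_of_int \<bar>j\<bar>) powr ?p \<le> ((1 + real_of_int \<bar>n\<bar>) * (1 + real_of_int \<bar>n - j\<bar>)) powr ?p"
    using \<beta> by (intro powr_mono2) auto
  hence "(1 + real_of_int \<bar>j\<bar>) powr ?p \<le> (1 + real_of_int \<bar>n\<bar>) powr ?p * (1 + real_of_int \<bar>n - j\<bar>) powr ?p"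
    by (simp add: powr_mult)
  from mult_left_mono[OF this, of "\<bar>f j\<bar>"]
  show "\<bar>f j\<bar> / (1 + real_of_int \<bar>n - j\<bar>) powr ?p \<le>
      (1 + real_of_int \<bar>n\<bar>) powr ?p * (\<bar>f j\<bar> / (1 + real_of_int \<bar>j\<bar>) powr ?p)"
    by (simp add: field_simps)
qed auto

lemma one_in_ell:
  assumes "\<beta> > 0" shows "(\<lambda>_. 1) \<in> ell \<beta>"
proof -
  let ?w = "\<lambda>m::int. 1 / (1 + real_of_int \<bar>m\<bar>) powr (1 + 2 * \<beta>)"
  have "summable (\<lambda>k. real (Suc k) powr (- (1 + 2 * \<beta>)))"
    using assms summable_real_powr_iff[of "- (1 + 2 * \<beta>)"] by (subst summable_Suc_iff) simp
  also have "(\<lambda>k. real (Suc k) powr (- (1 + 2 * \<beta>))) = (\<lambda>k. ?w (int k))"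
    by (auto simp: fun_eq_iff powr_minus_divide simp del: minus_add_distrib)
  finally have nat: "(\<lambda>k. ?w (int k)) summable_on UNIV"
    by (subst summable_on_UNIV_nonneg_real_iff) auto
  have "?w summable_on range int"
    using nat by (subst summable_on_reindex) (auto simp: o_def inj_on_def)
  moreover have "?w summable_on range (\<lambda>k. - int k)"
    using nat by (subst summable_on_reindex) (auto simp: o_def inj_on_def)
  moreover have "range int \<union> range (\<lambda>k. - int k) = UNIV"
    by (auto, metis int_cases2 rangeI)
  moreover have "?w summable_on (range int \<union> range (\<lambda>k. - int k))"
  proof -
    have "?w summable_on (range (\<lambda>k. - int k) - range int)"
      by (rule summable_on_subset_banach[OF calculation(2)]) auto
    hence "?w summable_on (range int \<union> (range (\<lambda>k. - int k) - range int))"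
      by (intro summable_on_Un_disjoint calculation(1)) auto
    thus ?thesis by simp
  qed
  ultimately show ?thesis by (simp add: ell_def)
qed

lemma heat_diff_const: "heat_diff \<tau> (\<lambda>_. c) = (\<lambda>_. 0)"
proof
  fix n
  have "((\<lambda>j. heat_kernel \<tau> (n - j) * c) has_sum c) UNIV"
    using has_sum_cmult_left[OF heat_kernel_cos_has_sum[of \<tau> n 0], of c] by (simp add: symb_def)
  thus "heat_diff \<tau> (\<lambda>_. c) n = 0"
    by (simp add: heat_diff_def heat_semigroup_def infsumI)
qed

lemma heat_diff_funpow_const:
  assumes "k \<ge> 1" shows "(heat_diff \<tau> ^^ k) (\<lambda>_. c) = (\<lambda>_. 0)"
proof -
  have "(heat_diff \<tau> ^^ Suc i) (\<lambda>_. c) = (\<lambda>_. 0)" for i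
    by (induction i) (simp_all add: heat_diff_const)
  thus ?thesis using assms by (metis Suc_le_D One_nat_def)
qed

text \<open>For fixed \<open>\<tau>\<close> the integrand is a convolution; the weighted bound on the difference kernel and
  \<open>f \<in> \<ell>\<^sub>\<beta>\<close> permit integrating the sum term by term, and the factor \<open>c\<^sub>\<beta>\<close> produced by each term is
  the one divided out in the definition.\<close>

lemma frac_laplacian_conv:
  assumes \<beta>: "\<beta> > 0" and f: "f \<in> ell \<beta>"
  shows "set_integrable lborel {0<..} (frac_integrand \<beta> f n)"
    and "((\<lambda>j. frac_kernel \<beta> (n - j) * f j) has_sum frac_laplacian \<beta> f n) UNIV"
proof -
  let ?k = "frac_order \<beta>" and ?c = "frac_const \<beta>"
  let ?H = "\<lambda>m \<tau>. diff_kernel ?k \<tau> m / \<tau> powr (1 + \<beta>)"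
  define F where "F = (\<lambda>j \<tau>. (indicator {0<..} \<tau> *\<^sub>R ?H (n - j) \<tau>) * f j)"
  define S where "S = (\<lambda>\<tau>. indicator {0<..} \<tau> *\<^sub>R frac_integrand \<beta> f n \<tau>)"
  obtain C where C: "\<And>m. (LBINT \<tau>:{0<..}. \<bar>?H m \<tau>\<bar>) \<le> C / (1 + \<bar>of_int m\<bar>) powr (1 + 2 * \<beta>)"
    using diff_kernel_weighted_bound(2)[OF \<beta>] by blast
  have F_int: "integrable lborel (F j)" for j
    using diff_kernel_weighted_bound(1)[OF \<beta>, of "n - j"]
    unfolding F_def set_integrable_def by (rule integrable_mult_left)
  have F_norm: "(\<lambda>j. \<integral>\<tau>. \<bar>F j \<tau>\<bar> \<partial>lborel) summable_on UNIV"
  proof (rule summable_on_comparison_test)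
    show "(\<lambda>j. C * (\<bar>f j\<bar> / (1 + real_of_int \<bar>n - j\<bar>) powr (1 + 2 * \<beta>))) summable_on UNIV"
      by (intro summable_on_cmult_right ell_shift_summable \<beta> f)
    fix j
    have "(\<integral>\<tau>. \<bar>F j \<tau>\<bar> \<partial>lborel) = (LBINT \<tau>:{0<..}. \<bar>?H (n - j) \<tau>\<bar>) * \<bar>f j\<bar>"
    proof -
      have "\<bar>F j \<tau>\<bar> = (indicator {0<..} \<tau> *\<^sub>R \<bar>?H (n - j) \<tau>\<bar>) * \<bar>f j\<bar>" for \<tau>
        by (simp add: F_def abs_mult)
      thus ?thesis unfolding set_lebesgue_integral_def by (simp only: integral_mult_left_zero)
    qed
    also have "\<dots> \<le> C / (1 + \<bar>of_int (n - j)\<bar>) powr (1 + 2 * \<beta>) * \<bar>f j\<bar>"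
      by (intro mult_right_mono C) auto
    finally show "(\<integral>\<tau>. \<bar>F j \<tau>\<bar> \<partial>lborel) \<le> C * (\<bar>f j\<bar> / (1 + real_of_int \<bar>n - j\<bar>) powr (1 + 2 * \<beta>))"
      by simp
  qed auto
  have F_sum: "((\<lambda>j. F j \<tau>) has_sum S \<tau>) UNIV" for \<tau>
  proof (cases "\<tau> > 0")
    case True
    from has_sum_cmult_left[OF heat_diff_funpow_has_sum[OF True ell_exp_growth[OF f], of ?k n], of "1 / \<tau> powr (1 + \<beta>)"]
    show ?thesis using True by (simp add: F_def S_def frac_integrand_def)
  qed (simp add: F_def S_def)
  show "set_integrable lborel {0<..} (frac_integrand \<beta> f n)"
    using has_sum_integral(1)[OF F_int F_norm F_sum] by (simp add: S_def set_integrable_def)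
  have "((\<lambda>j. \<integral>\<tau>. F j \<tau> \<partial>lborel) has_sum (\<integral>\<tau>. S \<tau> \<partial>lborel)) UNIV"
    by (rule has_sum_integral(2)[OF F_int F_norm F_sum])
  moreover have "(\<integral>\<tau>. F j \<tau> \<partial>lborel) = ?c * (frac_kernel \<beta> (n - j) * f j)" for j
  proof -
    have "(\<integral>\<tau>. F j \<tau> \<partial>lborel) = (LBINT \<tau>:{0<..}. ?H (n - j) \<tau>) * f j"
      unfolding F_def set_lebesgue_integral_def by (simp only: integral_mult_left_zero)
    thus ?thesis by (simp add: diff_kernel_weighted_integral[OF \<beta>] cos_coeff_symb_powr[OF \<beta>])
  qed
  moreover have "(\<integral>\<tau>. S \<tau> \<partial>lborel) = ?c * frac_laplacian \<beta> f n"
    using frac_const_nonzero[OF \<beta>] by (simp add: S_def frac_laplacian_def set_lebesgue_integral_def)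
  ultimately have "((\<lambda>j. ?c * (frac_kernel \<beta> (n - j) * f j)) has_sum ?c * frac_laplacian \<beta> f n) UNIV"
    by simp
  from has_sum_cmult_right[OF this, of "1 / ?c"]
  show "((\<lambda>j. frac_kernel \<beta> (n - j) * f j) has_sum frac_laplacian \<beta> f n) UNIV"
    using frac_const_nonzero[OF \<beta>] by simp
qed

text \<open>The kernel is the weighted integral of the difference kernel divided by \<open>c\<^sub>\<beta>\<close>, so it inherits the
  decay of that integral; no asymptotics of the Gamma function enter.\<close>

lemma frac_kernel_decay:
  assumes \<beta>: "\<beta> > 0"
  obtains C where "C > 0" "\<And>m. \<bar>frac_kernel \<beta> m\<bar> \<le> C / (1 + real_of_int \<bar>m\<bar>) powr (1 + 2 * \<beta>)"
proof -
  let ?H = "\<lambda>m \<tau>. diff_kernel (frac_order \<beta>) \<tau> m / \<tau> powr (1 + \<beta>)"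
  obtain C where C: "C > 0" "\<And>m. (LBINT \<tau>:{0<..}. \<bar>?H m \<tau>\<bar>) \<le> C / (1 + \<bar>of_int m\<bar>) powr (1 + 2 * \<beta>)"
    using diff_kernel_weighted_bound(2)[OF \<beta>] by blast
  have c: "\<bar>frac_const \<beta>\<bar> > 0" using frac_const_nonzero[OF \<beta>] by simp
  show ?thesis
  proof (rule that[of "C / \<bar>frac_const \<beta>\<bar>"])
    show "C / \<bar>frac_const \<beta>\<bar> > 0" using C c by simp
    fix m
    have "\<bar>frac_const \<beta>\<bar> * \<bar>frac_kernel \<beta> m\<bar> = \<bar>LBINT \<tau>:{0<..}. ?H m \<tau>\<bar>"
      by (simp add: diff_kernel_weighted_integral[OF \<beta>] cos_coeff_symb_powr[OF \<beta>] abs_mult)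
    also have "\<dots> \<le> (LBINT \<tau>:{0<..}. \<bar>?H m \<tau>\<bar>)"
      using set_integral_norm_bound[OF diff_kernel_weighted_bound(1)[OF \<beta>, of m]] by simp
    also have "\<dots> \<le> C / (1 + \<bar>of_int m\<bar>) powr (1 + 2 * \<beta>)" by (rule C)
    finally have "\<bar>frac_kernel \<beta> m\<bar> \<le> C / (1 + \<bar>of_int m\<bar>) powr (1 + 2 * \<beta>) / \<bar>frac_const \<beta>\<bar>"
      using c by (simp only: pos_le_divide_eq mult.commute)
    thus "\<bar>frac_kernel \<beta> m\<bar> \<le> C / \<bar>frac_const \<beta>\<bar> / (1 + real_of_int \<bar>m\<bar>) powr (1 + 2 * \<beta>)"
      by (simp add: mult.commute)
  qed
qed

theorem lemma1:
  fixes \<beta> :: real and f :: "int \<Rightarrow> real"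
  assumes "\<beta> > 0" and "f \<in> ell \<beta>"
  shows "frac_laplacian_well_defined \<beta> f \<and>
    (\<exists>C>0. \<forall>n.
       (\<lambda>j. \<bar>f j\<bar> / (1 + real_of_int \<bar>n - j\<bar> powr (1 + 2 * \<beta>))) summable_on UNIV \<and>
       \<bar>frac_laplacian \<beta> f n\<bar>
         \<le> C * (\<Sum>\<^sub>\<infinity>j\<in>UNIV. \<bar>f j\<bar> / (1 + real_of_int \<bar>n - j\<bar> powr (1 + 2 * \<beta>)))) \<and>
    (\<forall>n. ((\<lambda>j. frac_kernel \<beta> j * (f (n - j) - f n)) has_sum frac_laplacian \<beta> f n) UNIV)"
proof (intro conjI)
  note \<beta> = assms(1) and f = assms(2)
  let ?p = "1 + 2 * \<beta>"
  show "frac_laplacian_well_defined \<beta> f"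
    unfolding frac_laplacian_well_defined_def
    using frac_laplacian_conv(1)[OF \<beta> f]
    by (auto intro!: exp_kernel_summable exp_kernel_heat_kernel exp_growth_heat_diff_funpow
        ell_exp_growth[OF f])
  obtain C where C: "C > 0" "\<And>m. \<bar>frac_kernel \<beta> m\<bar> \<le> C / (1 + real_of_int \<bar>m\<bar>) powr ?p"
    using frac_kernel_decay[OF \<beta>] by blast
  show "\<exists>C>0. \<forall>n.
       (\<lambda>j. \<bar>f j\<bar> / (1 + real_of_int \<bar>n - j\<bar> powr ?p)) summable_on UNIV \<and>
       \<bar>frac_laplacian \<beta> f n\<bar> \<le> C * (\<Sum>\<^sub>\<infinity>j\<in>UNIV. \<bar>f j\<bar> / (1 + real_of_int \<bar>n - j\<bar> powr ?p))"
  proof (intro exI[of _ C] conjI allI)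
    fix n
    let ?v = "\<lambda>j. \<bar>f j\<bar> / (1 + real_of_int \<bar>n - j\<bar>) powr ?p"
    let ?w = "\<lambda>j. \<bar>f j\<bar> / (1 + real_of_int \<bar>n - j\<bar> powr ?p)"
    have pos: "1 + real_of_int \<bar>n - j\<bar> powr ?p > 0" for j
      by (simp add: add_pos_nonneg)
    show w: "?w summable_on UNIV"
    proof (rule summable_on_comparison_test)
      show "(\<lambda>j. 2 powr ?p * ?v j) summable_on UNIV"
        by (intro summable_on_cmult_right ell_shift_summable \<beta> f)
      fix j
      have "(1 + real_of_int \<bar>n - j\<bar>) powr ?p \<le> 2 powr ?p * (1 + real_of_int \<bar>n - j\<bar> powr ?p)"
        using \<beta> by (intro powr_le_one_plus) auto
      from mult_left_mono[OF this, of "\<bar>f j\<bar>"] show "?w j \<le> 2 powr ?p * ?v j"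
        using pos[of j] by (simp add: field_simps)
    qed (use pos in \<open>auto intro!: divide_nonneg_pos\<close>)
    have le: "\<bar>frac_kernel \<beta> (n - j) * f j\<bar> \<le> C * ?w j" for j
    proof -
      have "\<bar>frac_kernel \<beta> (n - j) * f j\<bar> \<le> C / (1 + real_of_int \<bar>n - j\<bar>) powr ?p * \<bar>f j\<bar>"
        unfolding abs_mult by (intro mult_right_mono C) auto
      also have "\<dots> \<le> C / (1 + real_of_int \<bar>n - j\<bar> powr ?p) * \<bar>f j\<bar>"
        using \<beta> C(1) pos[of j]
        by (intro mult_right_mono divide_left_mono one_plus_powr_le mult_pos_pos) auto
      finally show ?thesis by simp
    qed
    have "norm (frac_laplacian \<beta> f n) \<le> C * infsum ?w UNIV"
    proof (rule norm_infsum_le[OF frac_laplacian_conv(2)[OF \<beta> f]])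
      show "((\<lambda>j. C * ?w j) has_sum C * infsum ?w UNIV) UNIV"
        by (intro has_sum_cmult_right has_sum_infsum w)
    qed (use le in simp)
    thus "\<bar>frac_laplacian \<beta> f n\<bar> \<le> C * infsum ?w UNIV" by simp
  qed (rule C)
  show "\<forall>n. ((\<lambda>j. frac_kernel \<beta> j * (f (n - j) - f n)) has_sum frac_laplacian \<beta> f n) UNIV"
  proof
    fix n
    have reflect: "((\<lambda>j. frac_kernel \<beta> j * g (n - j)) has_sum frac_laplacian \<beta> g n) UNIV"
      if "g \<in> ell \<beta>" for g
      using frac_laplacian_conv(2)[OF \<beta> that, of n]
        has_sum_reindex_bij_betw[OF bij_betw_int_reflect[of n], of "\<lambda>j. frac_kernel \<beta> (n - j) * g j"]
      by simp
    \<comment> \<open>The representation applied to the constant sequence shows that the kernel has sum zero.\<close>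
    have "frac_laplacian \<beta> (\<lambda>_. 1) n = 0"
      by (simp add: frac_laplacian_def frac_integrand_def heat_diff_funpow_const[OF frac_order_bounds(2)]
          set_lebesgue_integral_def)
    with reflect[OF one_in_ell[OF \<beta>]] have "(frac_kernel \<beta> has_sum 0) UNIV" by simp
    from has_sum_diff_real[OF reflect[OF f] has_sum_cmult_left[OF this, of "f n"]]
    show "((\<lambda>j. frac_kernel \<beta> j * (f (n - j) - f n)) has_sum frac_laplacian \<beta> f n) UNIV"
      by (simp add: right_diff_distrib)
  qed
qed

end
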